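(* Let $K\in\mathcal{S}_0$, and let $H=\phi\circ\psi^{-1}$, where the inverse function $\psi^{-1}$ of $\psi$ is assumed to exist. (i) Assume that $\phi$ and $\psi$ satisfy one of the following conditions: (a) $\phi\in\widetilde{\Phi}$ and $\psi\in\widetilde{\Psi}$ with $H$ increasing; (b) $\phi,\psi\in\widetilde{\Phi}$ with $H$ decreasing. Then $$\frac{\widetilde{\Omega}_{\phi}^{orlicz}(K)}{n|K|}\leq H\bigg(\frac{\widetilde{\Omega}_{\psi}^{orlicz}(K)}{n|K|}\bigg)\ \text{ if } K\in\widetilde{\mathcal{S}},\qquad \frac{\widetilde{G}_{\phi}^{orlicz}(K)}{n|K|}\leq H\bigg(\frac{\widetilde{G}_{\psi}^{orlicz}(K)}{n|K|}\bigg)\ \text{ if } K\in\widetilde{\mathcal{K}}.$$ If instead $\phi$ and $\psi$ satisfy condition (c) $\phi\in\widetilde{\Psi}$ and $\psi\in\widetilde{\Phi}$ with $H$ increasing, then these inequalities hold with $\leq$ replaced by $\geq$. (ii) Assume that $\phi$ and $\psi$ satisfy condition (d): $H$ is concave and increasing, with either $\phi,\psi\in\widetilde{\Phi}$ or $\phi,\psi\in\widetilde{\Psi}$. Then for all $K\in\mathcal{S}_0$ $$\frac{\widetilde{\Omega}_{\phi}^{orlicz}(K)}{n|K|}\leq H\bigg(\frac{\widetilde{\Omega}_{\psi}^{orlicz}(K)}{n|K|}\bigg),\qquad \frac{\widetilde{G}_{\phi}^{orlicz}(K)}{n|K|}\leq H\bigg(\frac{\widetilde{G}_{\psi}^{orlicz}(K)}{n|K|}\bigg).$$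 If instead $\phi$ and $\psi$ satisfy one of the following conditions: (e) $H$ is convex and decreasing, with one of $\phi,\psi$ in $\widetilde{\Phi}$ and the other in $\widetilde{\Psi}$; (f) $H$ is convex and increasing, with either $\phi,\psi\in\widetilde{\Phi}$ or $\phi,\psi\in\widetilde{\Psi}$; then for all $K\in\mathcal S_0$ the inequalities displayed in (ii) hold with $\leq$ replaced by $\geq$.
   Context: $B_2^n$ is the closed unit Euclidean ball of $\mathbb{R}^n$, $S^{n-1}$ the unit sphere, $\sigma$ the spherical measure on $S^{n-1}$, $|\cdot|$ volume, $\omega_n=|B_2^n|$. A compact set $K$ that contains the closed segment from the origin to each of its points has radial function $\rho_K(u)=\max\{\lambda:\lambda u\in K\}$, $u\in S^{n-1}$; $K$ is a star body (about the origin) if $\rho_K$ is continuous and positive on $S^{n-1}$. $\mathcal{S}_0$ is the set of star bodies and $\mathcal{K}_0\subset\mathcal{S}_0$ the set of convex bodies with the origin in their interiors. For $K\in\mathcal{S}_0$ the polar body is $K^\circ=\{y:\langle x,y\rangle\leq1\ \forall x\in K\}$. $\mathcal{K}_c$ is the set of $K\in\mathcal{K}_0$ with centroid at the origin, $\mathcal{K}_s$ the set of $K\in\mathcal{K}_0$ with $K^\circ\in\mathcal{K}_c$; $\widetilde{\mathcal{K}}=\mathcal{K}_c\cup\mathcal{K}_s$ and $\widetilde{\mathcal{S}}=\{L\in\mathcal{S}_0: L^\circ\in\widetilde{\mathcal{K}}\}$. The volume radius is $\mathrm{vrad}(K)=(|K|/\omega_n)^{1/n}$. Throughout $\phi,\psi:(0,\infty)\to(0,\infty)$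 are continuous. $\widetilde{\Phi}$ is the set of $\phi$ for which $F(t)=\phi(t^{1/n})$ is either constant or strictly convex; $\widetilde{\Psi}$ the set of $\phi$ for which $F(t)=\phi(t^{1/n})$ is either constant or increasing and strictly concave. For $K,L\in\mathcal{S}_0$, $\widetilde{V}_\phi(K,L)=\frac1n\int_{S^{n-1}}\phi\!\left(\frac{\rho_L(u)}{\rho_K(u)}\right)\rho_K(u)^n\,d\sigma(u)$. For $\phi\in\widetilde{\Phi}$, the dual Orlicz $L_\phi$ affine and geominimal surface areas of $K\in\mathcal{S}_0$ are $\widetilde{\Omega}_{\phi}^{orlicz}(K)=\inf_{L\in\widetilde{\mathcal{S}}}\{n\widetilde{V}_\phi(K,\mathrm{vrad}(L^\circ)L)\}$ and $\widetilde{G}_{\phi}^{orlicz}(K)=\inf_{L\in\widetilde{\mathcal{K}}}\{n\widetilde{V}_\phi(K,\mathrm{vrad}(L^\circ)L)\}$. For $\phi\in\widetilde{\Psi}$ they are defined by the same formulas with $\sup$ in place of $\inf$. Convention for $H=\phi\circ\psi^{-1}$: $H(0)=\lim_{t\to0}H(t)$ if the limit exists and is finite, and $H(0)=\infty$ if this limit is $\infty$; similarly $H(\infty)=\lim_{t\to\infty}H(t)$ if the limit exists and is finite, and $H(\infty)=\infty$ if this limit is $\infty$. *)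

theory Defs
  imports "HOL-Analysis.Analysis"
begin

(* Spherical Lebesgue measure as the normalised cone measure:
   sigma(A) = n * vol {x. 0 < |x| <= 1 and x/|x| in A}, so that sigma(S^{n-1}) = n * omega_n. *)
definition spherical_measure :: "(real ^ 'n) measure" where
  "spherical_measure =
     scale_measure (of_nat CARD('n))
       (distr (restrict_space lborel (cball 0 1 - {0})) (restrict_space borel (sphere 0 1))
          (\<lambda>x. x /\<^sub>R norm x))"

definition radial :: "(real ^ 'n) set \<Rightarrow> real ^ 'n \<Rightarrow> real" where
  "radial K u = (GREATEST l. l *\<^sub>R u \<in> K)"

definition star_bodies :: "(real ^ 'n) set set" where
  "star_bodies = {K. K \<noteq> {} \<and> compact K \<and> (\<forall>x\<in>K. closed_segment 0 x \<subseteq> K) \<and>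
     continuous_on (sphere 0 1) (radial K) \<and> (\<forall>u\<in>sphere 0 1. 0 < radial K u)}"

definition convex_bodies :: "(real ^ 'n) set set" where
  "convex_bodies = {K. compact K \<and> convex K \<and> 0 \<in> interior K}"

definition polar_body :: "(real ^ 'n) set \<Rightarrow> (real ^ 'n) set" where
  "polar_body K = {y. \<forall>x\<in>K. x \<bullet> y \<le> 1}"

definition centroid :: "(real ^ 'n) set \<Rightarrow> real ^ 'n" where
  "centroid K = (LINT x:K|lborel. x) /\<^sub>R measure lborel K"

definition convex_bodies_c :: "(real ^ 'n) set set" where
  "convex_bodies_c = {K \<in> convex_bodies. centroid K = 0}"

definition convex_bodies_s :: "(real ^ 'n) set set" where
  "convex_bodies_s = {K \<in> convex_bodies. polar_body K \<in> convex_bodies_c}"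

definition K_tilde :: "(real ^ 'n) set set" where
  "K_tilde = convex_bodies_c \<union> convex_bodies_s"

definition S_tilde :: "(real ^ 'n) set set" where
  "S_tilde = {L \<in> star_bodies. polar_body L \<in> K_tilde}"

definition vrad :: "(real ^ 'n) set \<Rightarrow> real" where
  "vrad K = (measure lborel K / measure lborel (cball (0 :: real ^ 'n) 1)) powr (1 / real CARD('n))"

definition strictly_convex_on :: "real set \<Rightarrow> (real \<Rightarrow> real) \<Rightarrow> bool" where
  "strictly_convex_on S f \<longleftrightarrow> convex S \<and>
     (\<forall>x\<in>S. \<forall>y\<in>S. \<forall>u>0. \<forall>v>0. x \<noteq> y \<longrightarrow> u + v = 1 \<longrightarrow>
        f (u * x + v * y) < u * f x + v * f y)"

definition strictly_concave_on :: "real set \<Rightarrow> (real \<Rightarrow> real) \<Rightarrow> bool" where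
  "strictly_concave_on S f \<longleftrightarrow> strictly_convex_on S (\<lambda>x. - f x)"

(* A function (0,\<infinity>) \<rightarrow> (0,\<infinity>) is a total function on the reals, only ever used on {0<..}. *)
definition orlicz_function :: "(real \<Rightarrow> real) \<Rightarrow> bool" where
  "orlicz_function \<phi> \<longleftrightarrow> continuous_on {0<..} \<phi> \<and> (\<forall>t>0. 0 < \<phi> t)"

definition Phi_tilde :: "nat \<Rightarrow> (real \<Rightarrow> real) set" where
  "Phi_tilde n = {\<phi>. orlicz_function \<phi> \<and>
     (let F = (\<lambda>t. \<phi> (t powr (1 / real n))) in
        (\<exists>c. \<forall>t>0. F t = c) \<or> strictly_convex_on {0<..} F)}"

definition Psi_tilde :: "nat \<Rightarrow> (real \<Rightarrow> real) set" where
  "Psi_tilde n = {\<phi>. orlicz_function \<phi> \<and>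
     (let F = (\<lambda>t. \<phi> (t powr (1 / real n))) in
        (\<exists>c. \<forall>t>0. F t = c) \<or> (mono_on {0<..} F \<and> strictly_concave_on {0<..} F))}"

definition dual_mixed_volume ::
    "(real \<Rightarrow> real) \<Rightarrow> (real ^ 'n) set \<Rightarrow> (real ^ 'n) set \<Rightarrow> real" where
  "dual_mixed_volume \<phi> K L =
     (1 / real CARD('n)) *
       (LINT u|spherical_measure. \<phi> (radial L u / radial K u) * radial K u ^ CARD('n))"

(* The infimum is for Phi_tilde and the supremum for Psi_tilde; the two classes share only the
   constant functions, for which infimum and supremum coincide. *)
definition orlicz_extremum ::
    "(real ^ 'n) set set \<Rightarrow> (real \<Rightarrow> real) \<Rightarrow> (real ^ 'n) set \<Rightarrow> ereal" where
  "orlicz_extremum \<L> \<phi> K =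
     (let V = (\<lambda>L. ereal (real CARD('n) *
                 dual_mixed_volume \<phi> K ((\<lambda>x. vrad (polar_body L) *\<^sub>R x) ` L)))
      in if \<phi> \<in> Phi_tilde CARD('n) then (INF L\<in>\<L>. V L) else (SUP L\<in>\<L>. V L))"

definition Omega_orlicz :: "(real \<Rightarrow> real) \<Rightarrow> (real ^ 'n) set \<Rightarrow> ereal" where
  "Omega_orlicz \<phi> K = orlicz_extremum S_tilde \<phi> K"

definition G_orlicz :: "(real \<Rightarrow> real) \<Rightarrow> (real ^ 'n) set \<Rightarrow> ereal" where
  "G_orlicz \<phi> K = orlicz_extremum K_tilde \<phi> K"

(* H on its domain D, and by its (possibly infinite) limit along D at the points outside D.
   For D = (0,\<infinity>) this is the convention for H(0) and H(\<infinity>). *)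
definition limit_extension :: "real set \<Rightarrow> (real \<Rightarrow> real) \<Rightarrow> ereal \<Rightarrow> ereal" where
  "limit_extension D H x =
     (if x \<in> ereal ` D then ereal (H (real_of_ereal x))
      else Lim (at x within ereal ` D) (\<lambda>t. ereal (H (real_of_ereal t))))"

end

theory Submission
  imports Defs "HOL-Probability.Probability_Measure"
begin

text \<open>In polar coordinates \<open>n |K|\<close> is the integral of \<open>\<rho>\<^sub>K ^ n\<close> over the sphere, so
  \<open>d\<mu> = \<rho>\<^sub>K ^ n d\<sigma> / (n |K|)\<close> is a probability measure and the dual mixed volume of \<open>K\<close> and \<open>L\<close>,
  divided by \<open>|K|\<close>, is the \<open>\<mu>\<close>-mean of \<open>\<phi> (\<rho>\<^sub>L / \<rho>\<^sub>K)\<close>. For (i) the body \<open>L = K\<close> is a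
  competitor, at which the means for \<open>\<phi>\<close> and \<open>\<psi>\<close> are \<open>\<phi> c\<close> and \<open>\<psi> c\<close> with the same \<open>c\<close>. For (ii)
  Jensen's inequality compares the two means for every \<open>L\<close>, and since \<open>H\<close> is monotone and continuous, its
  limit extension may be interchanged with the extremum over \<open>L\<close>.\<close>

text \<open>The range \<open>D\<close> of \<open>\<psi>\<close> is an open interval of positive
  numbers, possibly a proper one. Every mean of \<open>\<psi>\<close> lies in \<open>D\<close>, but
  an extremum of such means can be an endpoint of \<open>D\<close>, even an infinite one, and there
  \<open>H\<close> has a value only as a limit. What remains true in all cases is that the extremum
  lies in the closure of the set of means, so that closed rays containing the relevant values of
  \<open>H\<close> also contain its extended value. Two kinds of estimate come out of this. A
  comparison of the extended value with one competitor rests on the direction in which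
  \<open>H\<close> is monotone. A comparison with the extremum of all values \<open>H (w i)\<close>
  goes the way that monotonicity does not give, and rests on approximating the extremum by means. On
  the geometric side the spherical measure is given as a pushforward of Lebesgue measure, so
  integrals of \<open>\<rho>^n\<close> have to be found as volumes of regions bounded by a radial
  graph.\<close>

section \<open>Limit extensions of monotone functions\<close>

text \<open>Monotone convergence along an arbitrary filter: for \<open>y\<close> below the supremum
  some value \<open>g a\<close> exceeds \<open>y\<close>, and that value is an eventual lower bound.
  With filters, finite and infinite endpoints need no separate treatment.\<close>

lemma tendsto_SUP_if_eventually_ge:
  fixes g :: "'a \<Rightarrow> 'b::{complete_linorder, linorder_topology}"
  assumes "\<And>a. a \<in> A \<Longrightarrow> eventually (\<lambda>t. g a \<le> g t) F" and "eventually (\<lambda>t. t \<in> A) F"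
  shows "(g \<longlongrightarrow> (SUP a\<in>A. g a)) F"
proof (rule order_tendstoI)
  fix y assume "y < (SUP a\<in>A. g a)"
  then obtain a where "a \<in> A" "y < g a" by (auto simp: less_SUP_iff)
  with assms(1)[of a] show "eventually (\<lambda>t. y < g t) F"
    by (auto elim: eventually_mono)
next
  fix y assume "(SUP a\<in>A. g a) < y"
  with assms(2) show "eventually (\<lambda>t. g t < y) F"
    by (auto elim!: eventually_mono intro: le_less_trans[OF SUP_upper])
qed

lemma tendsto_INF_if_eventually_le:
  fixes g :: "'a \<Rightarrow> 'b::{complete_linorder, linorder_topology}"
  assumes "\<And>a. a \<in> A \<Longrightarrow> eventually (\<lambda>t. g t \<le> g a) F" and "eventually (\<lambda>t. t \<in> A) F"
  shows "(g \<longlongrightarrow> (INF a\<in>A. g a)) F"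
proof (rule order_tendstoI)
  fix y assume "(INF a\<in>A. g a) < y"
  then obtain a where "a \<in> A" "g a < y" by (auto simp: INF_less_iff)
  with assms(1)[of a] show "eventually (\<lambda>t. g t < y) F"
    by (auto elim: eventually_mono)
next
  fix y assume "y < (INF a\<in>A. g a)"
  with assms(2) show "eventually (\<lambda>t. y < g t) F"
    by (auto elim!: eventually_mono intro: less_le_trans[OF _ INF_lower])
qed

lemma limit_extension_ereal: "x \<in> D \<Longrightarrow> limit_extension D H (ereal x) = ereal (H x)"
  by (simp add: limit_extension_def)

text \<open>With points of \<open>D\<close> on both sides, \<open>s\<close> would be finite and
  convexity would put it into \<open>D\<close>. Hence an outside point is approached from one side
  only, which is what makes monotone limits applicable.\<close>

lemma outside_interval_ereal:
  assumes "convex (D :: real set)" and "s \<notin> ereal ` D"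
  shows "(\<forall>t\<in>ereal ` D. t < s) \<or> (\<forall>t\<in>ereal ` D. s < t)"
proof (rule ccontr)
  assume "\<not> ?thesis"
  then obtain t1 t2 where t: "t1 \<in> D" "t2 \<in> D" "s \<le> ereal t1" "ereal t2 \<le> s" by force
  then obtain x where x: "s = ereal x" by (cases s) auto
  with t have "x \<in> D"
    using assms(1) by (auto simp: is_interval_convex_1[symmetric] intro: mem_is_interval_1_I)
  with x assms(2) show False by auto
qed

text \<open>Off \<open>D\<close> the extension is a \<open>Lim\<close>, which says nothing until a
  limit is known to exist and to be unique. Existence comes from monotonicity on the one side where
  \<open>D\<close> lies, uniqueness from \<open>s\<close> being a limit point; on \<open>D\<close>
  the claim is continuity of \<open>H\<close>.\<close>

lemma limit_extension_tendsto:
  fixes D :: "real set" and H :: "real \<Rightarrow> real"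
  assumes D: "convex D" and cont: "continuous_on D H" and mono: "mono_on D H \<or> antimono_on D H"
    and s: "s \<in> closure (ereal ` D)"
  shows "((\<lambda>t. ereal (H (real_of_ereal t))) \<longlongrightarrow> limit_extension D H s) (at s within ereal ` D)"
proof (cases "s \<in> ereal ` D")
  case True
  have "continuous_on (ereal ` D) (\<lambda>t. ereal (H (real_of_ereal t)))"
    by (intro continuous_on_ereal continuous_on_compose2[OF cont]
        continuous_on_subset[OF continuous_on_real]) auto
  with True show ?thesis
    by (auto simp: continuous_on_def limit_extension_def)
next
  case False
  let ?g = "\<lambda>t. ereal (H (real_of_ereal t))" and ?F = "at s within ereal ` D"
  have nontriv: "?F \<noteq> bot"
    using s False by (simp add: closure_def trivial_limit_within)
  have inD: "eventually (\<lambda>t. t \<in> ereal ` D) ?F"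
    by (simp add: eventually_at_filter)
  have inc: "eventually (\<lambda>t. a < t) ?F" if "a < s" for a
    using that by (auto simp: eventually_at_topological intro!: exI[of _ "{a<..}"])
  have dec: "eventually (\<lambda>t. t < a) ?F" if "s < a" for a
    using that by (auto simp: eventually_at_topological intro!: exI[of _ "{..<a}"])
  have ev: "\<exists>l. (?g \<longlongrightarrow> l) ?F"
    using outside_interval_ereal[OF D False] mono
  proof (elim disjE)
    assume below: "\<forall>t\<in>ereal ` D. t < s" and "mono_on D H"
    have "eventually (\<lambda>t. ?g a \<le> ?g t) ?F" if "a \<in> ereal ` D" for a
      using inc[OF below[rule_format, OF that]] inD
      by eventually_elim (use that \<open>mono_on D H\<close> in \<open>auto simp: mono_on_def\<close>)
    then show ?thesis using inD by (blast intro: tendsto_SUP_if_eventually_ge)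
  next
    assume below: "\<forall>t\<in>ereal ` D. t < s" and "antimono_on D H"
    have "eventually (\<lambda>t. ?g t \<le> ?g a) ?F" if "a \<in> ereal ` D" for a
      using inc[OF below[rule_format, OF that]] inD
      by eventually_elim (use that \<open>antimono_on D H\<close> in \<open>auto simp: monotone_on_def\<close>)
    then show ?thesis using inD by (blast intro: tendsto_INF_if_eventually_le)
  next
    assume above: "\<forall>t\<in>ereal ` D. s < t" and "mono_on D H"
    have "eventually (\<lambda>t. ?g t \<le> ?g a) ?F" if "a \<in> ereal ` D" for a
      using dec[OF above[rule_format, OF that]] inD
      by eventually_elim (use that \<open>mono_on D H\<close> in \<open>auto simp: mono_on_def\<close>)
    then show ?thesis using inD by (blast intro: tendsto_INF_if_eventually_le)
  next
    assume above: "\<forall>t\<in>ereal ` D. s < t" and "antimono_on D H"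
    have "eventually (\<lambda>t. ?g a \<le> ?g t) ?F" if "a \<in> ereal ` D" for a
      using dec[OF above[rule_format, OF that]] inD
      by eventually_elim (use that \<open>antimono_on D H\<close> in \<open>auto simp: monotone_on_def\<close>)
    then show ?thesis using inD by (blast intro: tendsto_SUP_if_eventually_ge)
  qed
  then show ?thesis
    using tendsto_Lim[OF nontriv] False by (auto simp: limit_extension_def)
qed

text \<open>All later inequalities for the extension are read off here, with \<open>C\<close> a
  closed ray of extended reals. Either \<open>s\<close> is a point of \<open>A\<close>, or it is a
  limit point of \<open>A\<close> and the limit along \<open>D\<close> can be taken along
  \<open>A\<close> alone.\<close>

lemma limit_extension_in_closed:
  fixes D :: "real set" and H :: "real \<Rightarrow> real"
  assumes D: "convex D" and cont: "continuous_on D H" and mono: "mono_on D H \<or> antimono_on D H"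
    and s: "s \<in> closure (ereal ` A)" and A: "A \<subseteq> D"
    and C: "closed C" "\<And>t. t \<in> A \<Longrightarrow> ereal (H t) \<in> C"
  shows "limit_extension D H s \<in> C"
proof (cases "s \<in> ereal ` A")
  case True
  with A C show ?thesis by (auto simp: limit_extension_ereal)
next
  case False
  have sD: "s \<in> closure (ereal ` D)" using s A by (meson closure_mono image_mono subsetD)
  have lim: "((\<lambda>t. ereal (H (real_of_ereal t))) \<longlongrightarrow> limit_extension D H s) (at s within ereal ` A)"
    using limit_extension_tendsto[OF D cont mono sD] A
    by (meson image_mono tendsto_within_subset)
  have "at s within ereal ` A \<noteq> bot"
    using s False by (simp add: closure_def trivial_limit_within)
  moreover have "eventually (\<lambda>t. ereal (H (real_of_ereal t)) \<in> C) (at s within ereal ` A)"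
    unfolding eventually_at_filter using C(2) by (intro always_eventually) auto
  ultimately show ?thesis
    using Lim_in_closed_set[OF C(1) _ _ lim] by blast
qed

section \<open>Extrema of a family of values and their images under the limit extension\<close>

lemma Sup_in_closure:
  fixes A :: "'a::{complete_linorder, linorder_topology} set"
  assumes "A \<noteq> {}" shows "Sup A \<in> closure A"
proof (cases "Sup A \<in> A")
  case False
  obtain a where a: "a \<in> A" using assms by auto
  with False have less: "a < Sup A" by (metis Sup_upper order_le_less)
  show ?thesis
    unfolding closure_iff_nhds_not_empty
  proof (intro allI impI)
    fix N U assume "U \<subseteq> N" "open U" "Sup A \<in> U"
    then obtain b where "b < Sup A" "{b<..Sup A} \<subseteq> U" using open_left[OF _ _ less] by blast
    moreover then obtain x where "x \<in> A" "b < x" by (auto simp: less_Sup_iff)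
    ultimately show "A \<inter> N \<noteq> {}" using \<open>U \<subseteq> N\<close> Sup_upper[of x A] by (auto simp: subset_iff)
  qed
qed (use closure_subset in blast)

lemma Inf_in_closure:
  fixes A :: "'a::{complete_linorder, linorder_topology} set"
  assumes "A \<noteq> {}" shows "Inf A \<in> closure A"
proof (cases "Inf A \<in> A")
  case False
  obtain a where a: "a \<in> A" using assms by auto
  with False have less: "Inf A < a" by (metis Inf_lower order_le_less)
  show ?thesis
    unfolding closure_iff_nhds_not_empty
  proof (intro allI impI)
    fix N U assume "U \<subseteq> N" "open U" "Inf A \<in> U"
    then obtain b where "Inf A < b" "{Inf A..<b} \<subseteq> U" using open_right[OF _ _ less] by blast
    moreover then obtain x where "x \<in> A" "x < b" by (auto simp: Inf_less_iff)
    ultimately show "A \<inter> N \<noteq> {}" using \<open>U \<subseteq> N\<close> Inf_lower[of x A] by (auto simp: subset_iff)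
  qed
qed (use closure_subset in blast)

text \<open>Discarding the part of \<open>D\<close> below \<open>a\<close> loses nothing near
  \<open>s\<close>: either \<open>s\<close> is \<open>a\<close> itself, or the open ray above
  \<open>a\<close> is a neighbourhood of \<open>s\<close>.\<close>

lemma limit_extension_in_closed_above:
  assumes "convex D" "continuous_on D H" "mono_on D H \<or> antimono_on D H"
    and s: "s \<in> closure (ereal ` D)" and a: "a \<in> D" "ereal a \<le> s"
    and C: "closed C" "\<And>t. t \<in> D \<Longrightarrow> a \<le> t \<Longrightarrow> ereal (H t) \<in> C"
  shows "limit_extension D H s \<in> C"
proof -
  have "s \<in> closure (ereal ` {t \<in> D. a \<le> t})"
  proof (cases "s = ereal a")
    case True
    then show ?thesis using a closure_subset[of "ereal ` {t \<in> D. a \<le> t}"] by auto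
  next
    case False
    with a have "s \<in> {ereal a<..} \<inter> closure (ereal ` D)" using s by auto
    also have "\<dots> \<subseteq> closure ({ereal a<..} \<inter> ereal ` D)" by (rule open_Int_closure_subset) simp
    also have "\<dots> \<subseteq> closure (ereal ` {t \<in> D. a \<le> t})" by (rule closure_mono) auto
    finally show ?thesis .
  qed
  from limit_extension_in_closed[OF assms(1-3) this _ C(1)] C(2) show ?thesis by auto
qed

lemma limit_extension_in_closed_below:
  assumes "convex D" "continuous_on D H" "mono_on D H \<or> antimono_on D H"
    and s: "s \<in> closure (ereal ` D)" and a: "a \<in> D" "s \<le> ereal a"
    and C: "closed C" "\<And>t. t \<in> D \<Longrightarrow> t \<le> a \<Longrightarrow> ereal (H t) \<in> C"
  shows "limit_extension D H s \<in> C"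
proof -
  have "s \<in> closure (ereal ` {t \<in> D. t \<le> a})"
  proof (cases "s = ereal a")
    case True
    then show ?thesis using a closure_subset[of "ereal ` {t \<in> D. t \<le> a}"] by auto
  next
    case False
    with a have "s \<in> {..<ereal a} \<inter> closure (ereal ` D)" using s by auto
    also have "\<dots> \<subseteq> closure ({..<ereal a} \<inter> ereal ` D)" by (rule open_Int_closure_subset) simp
    also have "\<dots> \<subseteq> closure (ereal ` {t \<in> D. t \<le> a})" by (rule closure_mono) auto
    finally show ?thesis .
  qed
  from limit_extension_in_closed[OF assms(1-3) this _ C(1)] C(2) show ?thesis by auto
qed

context
  fixes D :: "real set" and H :: "real \<Rightarrow> real" and I :: "'i set" and w :: "'i \<Rightarrow> real"
  assumes D: "convex D" and cont: "continuous_on D H" and mono: "mono_on D H \<or> antimono_on D H"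
    and I: "I \<noteq> {}" and w: "\<And>i. i \<in> I \<Longrightarrow> w i \<in> D"
begin

lemma SUP_closure_values: "(SUP i\<in>I. ereal (w i)) \<in> closure (ereal ` w ` I)"
  using Sup_in_closure[of "ereal ` w ` I"] I by (simp add: image_comp)

lemma INF_closure_values: "(INF i\<in>I. ereal (w i)) \<in> closure (ereal ` w ` I)"
  using Inf_in_closure[of "ereal ` w ` I"] I by (simp add: image_comp)

lemma closure_values_subset: "closure (ereal ` w ` I) \<subseteq> closure (ereal ` D)"
  using w by (intro closure_mono) auto

text \<open>A limit of values \<open>H (w i)\<close> cannot exceed their supremum. The point
  \<open>s\<close> is left free because both the supremum and the infimum of the family are inserted
  for it.\<close>

lemma limit_extension_closure_le_SUP:
  assumes "s \<in> closure (ereal ` w ` I)"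
  shows "limit_extension D H s \<le> (SUP i\<in>I. ereal (H (w i)))"
proof -
  have "limit_extension D H s \<in> {..(SUP i\<in>I. ereal (H (w i)))}"
    using w by (intro limit_extension_in_closed[OF D cont mono assms]) (auto intro: SUP_upper)
  then show ?thesis by simp
qed

lemma limit_extension_closure_ge_INF:
  assumes "s \<in> closure (ereal ` w ` I)"
  shows "(INF i\<in>I. ereal (H (w i))) \<le> limit_extension D H s"
proof -
  have "limit_extension D H s \<in> {(INF i\<in>I. ereal (H (w i)))..}"
    using w by (intro limit_extension_in_closed[OF D cont mono assms]) (auto intro: INF_lower)
  then show ?thesis by simp
qed

text \<open>Beyond \<open>w i\<close> all values of \<open>H\<close> stay in one closed ray bounded
  by \<open>H (w i)\<close>, and the supremum can be approached through such points. The three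
  companions below vary the monotonicity and the side.\<close>

lemma mono_le_limit_extension_SUP:
  assumes "mono_on D H" "i \<in> I"
  shows "ereal (H (w i)) \<le> limit_extension D H (SUP i\<in>I. ereal (w i))"
proof -
  have "limit_extension D H (SUP i\<in>I. ereal (w i)) \<in> {ereal (H (w i))..}"
    using subsetD[OF closure_values_subset SUP_closure_values]
  proof (rule limit_extension_in_closed_above[OF D cont mono])
    show "w i \<in> D" using assms w by auto
    then show "ereal (H t) \<in> {ereal (H (w i))..}" if "t \<in> D" "w i \<le> t" for t
      using that monotone_onD[OF assms(1)] by auto
  qed (use assms in \<open>auto intro: SUP_upper\<close>)
  then show ?thesis by simp
qed

lemma antimono_limit_extension_SUP_le:
  assumes "antimono_on D H" "i \<in> I"
  shows "limit_extension D H (SUP i\<in>I. ereal (w i)) \<le> ereal (H (w i))"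
proof -
  have "limit_extension D H (SUP i\<in>I. ereal (w i)) \<in> {..ereal (H (w i))}"
    using subsetD[OF closure_values_subset SUP_closure_values]
  proof (rule limit_extension_in_closed_above[OF D cont mono])
    show "w i \<in> D" using assms w by auto
    then show "ereal (H t) \<in> {..ereal (H (w i))}" if "t \<in> D" "w i \<le> t" for t
      using that monotone_onD[OF assms(1)] by auto
  qed (use assms in \<open>auto intro: SUP_upper\<close>)
  then show ?thesis by simp
qed

lemma mono_limit_extension_INF_le:
  assumes "mono_on D H" "i \<in> I"
  shows "limit_extension D H (INF i\<in>I. ereal (w i)) \<le> ereal (H (w i))"
proof -
  have "limit_extension D H (INF i\<in>I. ereal (w i)) \<in> {..ereal (H (w i))}"
    using subsetD[OF closure_values_subset INF_closure_values]
  proof (rule limit_extension_in_closed_below[OF D cont mono])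
    show "w i \<in> D" using assms w by auto
    then show "ereal (H t) \<in> {..ereal (H (w i))}" if "t \<in> D" "t \<le> w i" for t
      using that monotone_onD[OF assms(1)] by auto
  qed (use assms in \<open>auto intro: INF_lower\<close>)
  then show ?thesis by simp
qed

lemma antimono_le_limit_extension_INF:
  assumes "antimono_on D H" "i \<in> I"
  shows "ereal (H (w i)) \<le> limit_extension D H (INF i\<in>I. ereal (w i))"
proof -
  have "limit_extension D H (INF i\<in>I. ereal (w i)) \<in> {ereal (H (w i))..}"
    using subsetD[OF closure_values_subset INF_closure_values]
  proof (rule limit_extension_in_closed_below[OF D cont mono])
    show "w i \<in> D" using assms w by auto
    then show "ereal (H t) \<in> {ereal (H (w i))..}" if "t \<in> D" "t \<le> w i" for t
      using that monotone_onD[OF assms(1)] by auto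
  qed (use assms in \<open>auto intro: INF_lower\<close>)
  then show ?thesis by simp
qed

end

lemma SUP_ereal_divide:
  fixes f :: "'i \<Rightarrow> ereal" assumes "0 < c"
  shows "(SUP i\<in>I. f i) / ereal c = (SUP i\<in>I. f i / ereal c)"
proof (rule antisym)
  show "(SUP i\<in>I. f i / ereal c) \<le> (SUP i\<in>I. f i) / ereal c"
    using assms by (intro SUP_least ereal_divide_right_mono SUP_upper) auto
  have "f i \<le> ereal c * (SUP i\<in>I. f i / ereal c)" if "i \<in> I" for i
    using SUP_upper[OF that, of "\<lambda>i. f i / ereal c"] assms by (simp add: ereal_divide_le_pos)
  then have "(SUP i\<in>I. f i) \<le> ereal c * (SUP i\<in>I. f i / ereal c)" by (rule SUP_least)
  then show "(SUP i\<in>I. f i) / ereal c \<le> (SUP i\<in>I. f i / ereal c)"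
    using assms by (simp add: ereal_divide_le_pos)
qed

lemma INF_ereal_divide:
  fixes f :: "'i \<Rightarrow> ereal" assumes "0 < c"
  shows "(INF i\<in>I. f i) / ereal c = (INF i\<in>I. f i / ereal c)"
proof (rule antisym)
  show "(INF i\<in>I. f i) / ereal c \<le> (INF i\<in>I. f i / ereal c)"
    using assms by (intro INF_greatest ereal_divide_right_mono INF_lower) auto
  have "ereal c * (INF i\<in>I. f i / ereal c) \<le> f i" if "i \<in> I" for i
    using INF_lower[OF that, of "\<lambda>i. f i / ereal c"] assms by (simp add: ereal_le_divide_pos)
  then have "ereal c * (INF i\<in>I. f i / ereal c) \<le> (INF i\<in>I. f i)" by (rule INF_greatest)
  then show "(INF i\<in>I. f i / ereal c) \<le> (INF i\<in>I. f i) / ereal c"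
    using assms by (simp add: ereal_le_divide_pos)
qed

section \<open>Star-shaped neighbourhoods of the origin\<close>

text \<open>This covers the star bodies as well as the convex bodies. Continuity of the radial function
  is not required: it is upper semicontinuous, hence measurable, and it is bounded away from 0 and
  infinity, which is all that the integrals need.\<close>

definition star_neighbourhood :: "(real ^ 'n) set \<Rightarrow> bool" where
  "star_neighbourhood L \<longleftrightarrow>
     compact L \<and> (\<forall>x\<in>L. closed_segment 0 x \<subseteq> L) \<and> (\<exists>r>0. cball 0 r \<subseteq> L)"

lemma star_neighbourhood_scaleR_mem:
  assumes "star_neighbourhood L" "x \<in> L" "0 \<le> t" "t \<le> 1"
  shows "t *\<^sub>R x \<in> L"
  using assms unfolding star_neighbourhood_def closed_segment_def by force

lemma radial_eqI:
  assumes "l *\<^sub>R u \<in> L" "\<And>k. k *\<^sub>R u \<in> L \<Longrightarrow> k \<le> l" shows "radial L u = l"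
  unfolding radial_def using assms by (rule Greatest_equality)

text \<open>\<open>GREATEST\<close> carries information only once a maximum exists. As
  \<open>u\<close> has norm 1, compactness of \<open>L\<close> makes the set of parameters along the
  line through \<open>u\<close> closed and bounded, and the origin makes it nonempty.\<close>

lemma radial_mem_and_greatest:
  assumes L: "compact L" "0 \<in> L" and u: "u \<in> sphere 0 1"
  shows "radial L u *\<^sub>R u \<in> L \<and> (\<forall>k. k *\<^sub>R u \<in> L \<longrightarrow> k \<le> radial L u)"
proof -
  let ?S = "(\<lambda>k. k *\<^sub>R u) -` L"
  obtain B where B: "\<And>x. x \<in> L \<Longrightarrow> norm x \<le> B"
    using compact_imp_bounded[OF L(1)] by (auto simp: bounded_iff)
  have "bounded ?S" unfolding bounded_iff using B u by force
  moreover have "closed ?S"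
    using compact_imp_closed[OF L(1)] by (intro continuous_closed_vimage) auto
  moreover have "?S \<noteq> {}" using L(2) by (metis empty_iff scaleR_zero_left vimageI2)
  ultimately obtain l where "l *\<^sub>R u \<in> L" "\<forall>k. k *\<^sub>R u \<in> L \<longrightarrow> k \<le> l"
    using compact_attains_sup[of ?S] by (auto simp: compact_eq_bounded_closed)
  then show ?thesis using radial_eqI[of l u L] by auto
qed

lemma star_neighbourhood_zero: "star_neighbourhood L \<Longrightarrow> 0 \<in> L"
  unfolding star_neighbourhood_def by force

text \<open>From right to left this is maximality; from left to right star-shapedness is used, since
  \<open>k *\<^sub>R u\<close> is a contraction of the outermost point on the ray. Superlevel sets
  of the radial function thereby become preimages of \<open>L\<close>.\<close>

lemma le_radial_iff:
  assumes L: "star_neighbourhood L" and u: "u \<in> sphere 0 1" and "0 \<le> k"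
  shows "k \<le> radial L u \<longleftrightarrow> k *\<^sub>R u \<in> L"
proof
  note r = radial_mem_and_greatest[OF _ star_neighbourhood_zero[OF L] u]
  have L': "compact L" using L by (simp add: star_neighbourhood_def)
  show "k \<le> radial L u" if "k *\<^sub>R u \<in> L" using r[OF L'] that by auto
  assume k: "k \<le> radial L u"
  show "k *\<^sub>R u \<in> L"
  proof (cases "radial L u = 0")
    case True
    with k \<open>0 \<le> k\<close> show ?thesis using star_neighbourhood_zero[OF L] by simp
  next
    case False
    with k \<open>0 \<le> k\<close> star_neighbourhood_scaleR_mem[OF L, of "radial L u *\<^sub>R u" "k / radial L u"] r[OF L']
    show ?thesis by (auto simp: field_simps)
  qed
qed

lemma radial_bounds:
  assumes L: "star_neighbourhood (L :: (real ^ 'n) set)"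
  obtains r R where "0 < r" "\<And>u. u \<in> sphere 0 1 \<Longrightarrow> r \<le> radial L u \<and> radial L u \<le> R"
proof -
  obtain r where r: "0 < r" "cball 0 r \<subseteq> L" using L by (auto simp: star_neighbourhood_def)
  obtain R where R: "\<And>x. x \<in> L \<Longrightarrow> norm x \<le> R"
    using L compact_imp_bounded[of L] by (auto simp: star_neighbourhood_def bounded_iff)
  have "r \<le> radial L u \<and> radial L u \<le> R" if u: "u \<in> sphere 0 1" for u
  proof
    show *: "r \<le> radial L u" using le_radial_iff[OF L u, of r] r u by (auto simp: subset_iff)
    have "radial L u *\<^sub>R u \<in> L" using le_radial_iff[OF L u, of "radial L u"] r * by auto
    from R[OF this] show "radial L u \<le> R" using u by auto
  qed
  with r that show ?thesis by blast
qed

lemma radial_pos: "star_neighbourhood L \<Longrightarrow> u \<in> sphere 0 1 \<Longrightarrow> 0 < radial L u"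
  by (metis radial_bounds less_le_trans)

lemma mem_iff_norm_le_radial:
  assumes "star_neighbourhood L" "x \<noteq> 0"
  shows "x \<in> L \<longleftrightarrow> norm x \<le> radial L (x /\<^sub>R norm x)"
  using le_radial_iff[OF assms(1), of "x /\<^sub>R norm x" "norm x"] assms(2) by simp

lemma borel_measurable_radial:
  assumes L: "star_neighbourhood (L :: (real ^ 'n) set)"
  shows "radial L \<in> borel_measurable (restrict_space borel (sphere 0 1))"
  unfolding borel_measurable_iff_ge
proof
  fix a :: real
  show "{w \<in> space (restrict_space borel (sphere 0 1)). a \<le> radial L w}
          \<in> sets (restrict_space borel (sphere 0 1))"
  proof (cases "0 \<le> a")
    case True
    then have "{w \<in> space (restrict_space borel (sphere 0 1)). a \<le> radial L w}
      = (\<lambda>u. a *\<^sub>R u) -` L \<inter> sphere 0 1"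
      using le_radial_iff[OF L] by (auto simp: space_restrict_space)
    moreover have "closed ((\<lambda>u. a *\<^sub>R u) -` L)"
      using L compact_imp_closed by (intro continuous_closed_vimage) (auto simp: star_neighbourhood_def)
    ultimately show ?thesis
      by (auto simp: sets_restrict_space_iff borel_closed intro!: sets.Int)
  next
    case False
    then have "{w \<in> space (restrict_space borel (sphere 0 1)). a \<le> radial L w}
      = space (restrict_space borel (sphere 0 1))"
      using radial_pos[OF L] by (force simp: space_restrict_space)
    then show ?thesis by (metis sets.top)
  qed
qed

lemma star_neighbourhood_scaled:
  assumes "star_neighbourhood L" "0 < c"
  shows "star_neighbourhood ((\<lambda>x. c *\<^sub>R x) ` L)"
proof -
  obtain r where r: "0 < r" "cball 0 r \<subseteq> L" using assms by (auto simp: star_neighbourhood_def)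
  have "cball 0 (c * r) \<subseteq> (\<lambda>x. c *\<^sub>R x) ` L"
  proof
    fix x :: "real ^ 'a" assume "x \<in> cball 0 (c * r)"
    then have "x /\<^sub>R c \<in> L" using r assms(2) by (auto simp: subset_iff field_simps)
    then show "x \<in> (\<lambda>x. c *\<^sub>R x) ` L" using assms(2) by (force simp: image_iff)
  qed
  moreover have "0 < c * r" using r assms by simp
  moreover have "closed_segment 0 (c *\<^sub>R x) \<subseteq> (\<lambda>x. c *\<^sub>R x) ` L" if "x \<in> L" for x
  proof
    fix z assume "z \<in> closed_segment 0 (c *\<^sub>R x)"
    then obtain t where "0 \<le> t" "t \<le> 1" "z = c *\<^sub>R (t *\<^sub>R x)"
      by (auto simp: closed_segment_def mult.commute)
    then show "z \<in> (\<lambda>x. c *\<^sub>R x) ` L"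
      using star_neighbourhood_scaleR_mem[OF assms(1) that] by blast
  qed
  moreover have "compact ((\<lambda>x. c *\<^sub>R x) ` L)"
    using assms by (auto simp: star_neighbourhood_def intro: compact_scaling)
  ultimately show ?thesis unfolding star_neighbourhood_def by blast
qed

lemma radial_scaled:
  assumes "star_neighbourhood L" "0 < c" "u \<in> sphere 0 1"
  shows "radial ((\<lambda>x. c *\<^sub>R x) ` L) u = c * radial L u"
proof (rule radial_eqI)
  have L: "compact L" using assms(1) by (simp add: star_neighbourhood_def)
  note r = radial_mem_and_greatest[OF L star_neighbourhood_zero[OF assms(1)] assms(3)]
  show "(c * radial L u) *\<^sub>R u \<in> (\<lambda>x. c *\<^sub>R x) ` L" 
    using r by (auto intro!: image_eqI[of _ _ "radial L u *\<^sub>R u"])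
  fix k assume "k *\<^sub>R u \<in> (\<lambda>x. c *\<^sub>R x) ` L"
  then obtain x where x: "x \<in> L" "k *\<^sub>R u = c *\<^sub>R x" by auto
  then have "x = inverse c *\<^sub>R (k *\<^sub>R u)" using assms(2) by simp
  then have "x = (k / c) *\<^sub>R u" by (simp add: divide_inverse_commute)
  then have "k / c \<le> radial L u" using r x by auto
  then show "k \<le> c * radial L u" using assms(2) by (simp add: field_simps)
qed

text \<open>The continuous positive radial function attains a positive minimum on the compact
  sphere, and this minimum is the radius of an inscribed ball.\<close>

lemma star_neighbourhood_star_body:
  assumes "K \<in> star_bodies" shows "star_neighbourhood (K :: (real ^ 'n) set)"
proof -
  have K: "compact K" "\<And>x. x \<in> K \<Longrightarrow> closed_segment 0 x \<subseteq> K" "K \<noteq> {}"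
    "continuous_on (sphere 0 1) (radial K)" "\<And>u. u \<in> sphere 0 1 \<Longrightarrow> 0 < radial K u"
    using assms by (auto simp: star_bodies_def)
  have 0: "0 \<in> K" using K(2,3) by force
  have "sphere (0 :: real ^ 'n) 1 \<noteq> {}" by simp
  then obtain u0 where u0: "u0 \<in> sphere 0 1" "\<And>u. u \<in> sphere 0 1 \<Longrightarrow> radial K u0 \<le> radial K u"
    using continuous_attains_inf[OF compact_sphere _ K(4)] by auto
  have "cball 0 (radial K u0) \<subseteq> K"
  proof
    fix x :: "real ^ 'n" assume x: "x \<in> cball 0 (radial K u0)"
    show "x \<in> K"
    proof (cases "x = 0")
      case False
      let ?u = "x /\<^sub>R norm x"
      have u: "?u \<in> sphere 0 1" using False by simp
      have "radial K ?u *\<^sub>R ?u \<in> K" using radial_mem_and_greatest[OF K(1) 0 u] by auto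
      from K(2)[OF this] have *: "t *\<^sub>R (radial K ?u *\<^sub>R ?u) \<in> K" if "0 \<le> t" "t \<le> 1" for t
        using that by (force simp: closed_segment_def)
      have "norm x \<le> radial K ?u" using u0(2)[OF u] x by simp
      then have "(norm x / radial K ?u) *\<^sub>R (radial K ?u *\<^sub>R ?u) \<in> K"
        using K(5)[OF u] by (intro *) auto
      then show ?thesis using K(5)[OF u] False by simp
    qed (use 0 in simp)
  qed
  with u0(1) K show ?thesis unfolding star_neighbourhood_def by blast
qed

lemma star_neighbourhood_convex_body:
  assumes "K \<in> convex_bodies" shows "star_neighbourhood K"
proof -
  have "closed_segment 0 x \<subseteq> K" if "x \<in> K" for x
    using assms that interior_subset[of K]
    by (intro closed_segment_subset) (auto simp: convex_bodies_def)
  with assms show ?thesis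
    by (auto simp: star_neighbourhood_def convex_bodies_def mem_interior_cball)
qed

lemma measure_star_neighbourhood_pos:
  assumes "star_neighbourhood (L :: (real ^ 'n) set)"
  shows "0 < measure lborel L"
proof -
  obtain r where r: "0 < r" "cball 0 r \<subseteq> L" using assms by (auto simp: star_neighbourhood_def)
  have "0 < measure lborel (cball (0 :: real ^ 'n) r)"
    using r content_cball_pos by simp
  also have "\<dots> \<le> measure lborel L"
    using assms r by (intro measure_mono_fmeasurable fmeasurable_compact)
      (auto simp: star_neighbourhood_def borel_closed)
  finally show ?thesis .
qed

text \<open>Polarity reverses inclusions, so radii \<open>r\<close> and \<open>R\<close> of an inner
  and an outer ball of \<open>L\<close> give radii \<open>1 / R\<close> and \<open>1 / r\<close> for
  the polar body. The outer ball matters as much as the inner one, because \<open>measure\<close>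
  assigns 0 to a set of infinite volume.\<close>

lemma vrad_polar_body_pos:
  assumes L: "star_neighbourhood (L :: (real ^ 'n) set)"
  shows "0 < vrad (polar_body L)"
proof -
  obtain r where r: "0 < r" "cball 0 r \<subseteq> L" using L by (auto simp: star_neighbourhood_def)
  obtain R where R: "0 < R" "\<And>x. x \<in> L \<Longrightarrow> norm x \<le> R"
    using L compact_imp_bounded[of L] by (auto simp: star_neighbourhood_def bounded_pos)
  have "norm y \<le> 1 / r" if "y \<in> polar_body L" for y
  proof (cases "y = 0")
    case False
    \<comment> \<open>The test point is where the ray through \<open>y\<close> leaves the inner
      ball; its inner product with \<open>y\<close> is \<open>r * norm y\<close>.\<close>
    then have "(r / norm y) *\<^sub>R y \<in> L" using r by (auto simp: subset_iff)
    with that have "((r / norm y) *\<^sub>R y) \<bullet> y \<le> 1" by (auto simp: polar_body_def)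
    with False r show ?thesis by (simp add: dot_square_norm power2_eq_square field_simps)
  qed (use r in simp)
  then have "bounded (polar_body L)" by (auto simp: bounded_iff)
  moreover have "closed (polar_body L)"
  proof -
    have "polar_body L = (\<Inter>x\<in>L. {y. x \<bullet> y \<le> 1})" by (auto simp: polar_body_def)
    then show ?thesis by (auto intro!: closed_INT closed_halfspace_le)
  qed
  ultimately have "compact (polar_body L)" by (simp add: compact_eq_bounded_closed)
  moreover have "cball 0 (1 / R) \<subseteq> polar_body L"
  proof
    fix y :: "real ^ 'n" assume y: "y \<in> cball 0 (1 / R)"
    have "x \<bullet> y \<le> 1" if "x \<in> L" for x
    proof -
      have "x \<bullet> y \<le> norm x * norm y" by (rule norm_cauchy_schwarz)
      also have "\<dots> \<le> R * (1 / R)" using y R that by (intro mult_mono) auto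
      finally show ?thesis using R by simp
    qed
    then show "y \<in> polar_body L" by (simp add: polar_body_def)
  qed
  moreover have "closed_segment 0 y \<subseteq> polar_body L" if "y \<in> polar_body L" for y
  proof (rule closed_segment_subset)
    show "convex (polar_body L)"
      by (auto simp: polar_body_def convex_def inner_add_right intro!: convex_bound_le)
  qed (use that in \<open>auto simp: polar_body_def\<close>)
  ultimately have "star_neighbourhood (polar_body L)"
    using R(1) unfolding star_neighbourhood_def by (auto intro!: exI[of _ "1 / R"])
  from measure_star_neighbourhood_pos[OF this] show ?thesis
    using content_cball_pos[of 1 "0 :: real ^ 'n"] by (simp add: vrad_def)
qed

section \<open>Volume in polar coordinates\<close>

lemma emeasure_lborel_scaleR_image:
  fixes A :: "(real ^ 'n) set"
  assumes A: "A \<in> sets borel" and c: "0 < c"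
  shows "(\<lambda>x. c *\<^sub>R x) ` A \<in> sets borel"
    and "emeasure lborel ((\<lambda>x. c *\<^sub>R x) ` A) = ennreal (c ^ CARD('n)) * emeasure lborel A"
proof -
  have "(\<lambda>x. c *\<^sub>R x) ` A = (\<lambda>x. x /\<^sub>R c) -` A \<inter> space borel"
    using c by (force simp: image_iff)
  also have "\<dots> \<in> sets borel" by (rule measurable_sets[OF _ A]) measurable
  finally show *: "(\<lambda>x. c *\<^sub>R x) ` A \<in> sets borel" .
  show "emeasure lborel ((\<lambda>x. c *\<^sub>R x) ` A) = ennreal (c ^ CARD('n)) * emeasure lborel A"
    using emeasure_lebesgue_affine[of c 0 A] A c * by (simp add: ennreal_power)
qed

text \<open>The spherical measure without its factor \<open>n\<close>: the mass of a set of
  directions is the volume of the sector of the unit ball over it.\<close>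

definition cone_measure :: "(real ^ 'n) measure" where
  "cone_measure = distr (restrict_space lborel (cball 0 1 - {0})) (restrict_space borel (sphere 0 1))
     (\<lambda>x. x /\<^sub>R norm x)"

lemma sets_cone_measure [measurable_cong]:
  "sets cone_measure = sets (restrict_space borel (sphere 0 1))"
  and space_cone_measure: "space cone_measure = sphere 0 1"
  by (simp_all add: cone_measure_def space_restrict_space)

lemma borel_if_sets_cone_measure: "A \<in> sets cone_measure \<Longrightarrow> A \<in> sets borel"
  by (auto simp: sets_cone_measure sets_restrict_space_iff borel_closed)

lemma cone_measurable:
  assumes "A \<in> sets cone_measure" "Measurable.pred borel P"
  shows "{x. x \<noteq> 0 \<and> P (norm x) \<and> x /\<^sub>R norm x \<in> A} \<in> sets borel"
proof -
  have [measurable]: "A \<in> sets borel" "Measurable.pred borel P"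
    using borel_if_sets_cone_measure[OF assms(1)] assms(2) by auto
  have "{x \<in> space borel. x \<noteq> 0 \<and> P (norm x) \<and> x /\<^sub>R norm x \<in> A} \<in> sets borel" by measurable
  then show ?thesis by simp
qed

text \<open>Passing to the open ball is free because the unit sphere is a null set; it prepares for
  the strict inequalities in the regions below.\<close>

lemma emeasure_cone_measure:
  assumes A: "A \<in> sets cone_measure"
  shows "emeasure cone_measure A = emeasure lborel {x. x \<noteq> 0 \<and> norm x < 1 \<and> x /\<^sub>R norm x \<in> A}"
proof -
  let ?B = "cball 0 1 - {0 :: real ^ 'n}"
  have B: "?B \<in> sets borel" by (intro sets.Diff) (auto simp: borel_closed)
  have [measurable]: "(\<lambda>x. x /\<^sub>R norm x) \<in> measurable (restrict_space lborel ?B) (restrict_space borel (sphere 0 1))"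
    by (rule measurable_restrict_space2)
       (auto simp: space_restrict_space intro!: measurable_restrict_space1)
  have "emeasure cone_measure A = emeasure (restrict_space lborel ?B)
      ((\<lambda>x. x /\<^sub>R norm x) -` A \<inter> space (restrict_space lborel ?B))"
    using A unfolding cone_measure_def by (intro emeasure_distr) (auto simp: sets_cone_measure)
  also have "(\<lambda>x. x /\<^sub>R norm x) -` A \<inter> space (restrict_space lborel ?B)
      = {x. x \<noteq> 0 \<and> norm x \<le> 1 \<and> x /\<^sub>R norm x \<in> A}"
    by (auto simp: space_restrict_space)
  also have "emeasure (restrict_space lborel ?B) \<dots> = emeasure lborel \<dots>"
    using B by (intro emeasure_restrict_space) auto
  also have "\<dots> = emeasure lborel {x. x \<noteq> 0 \<and> norm x < 1 \<and> x /\<^sub>R norm x \<in> A}"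
  proof (rule emeasure_eq_AE)
    have "sphere (0 :: real ^ 'n) 1 \<in> null_sets lborel"
      using negligible_sphere[of "0 :: real ^ 'n" 1] by (simp add: negligible_iff_null_sets null_sets_completion_iff borel_closed)
    then have "AE x in lborel. x \<notin> sphere (0 :: real ^ 'n) 1" by (rule AE_not_in)
    then show "AE x in lborel. x \<in> {x. x \<noteq> 0 \<and> norm x \<le> 1 \<and> x /\<^sub>R norm x \<in> A} \<longleftrightarrow>
        x \<in> {x. x \<noteq> 0 \<and> norm x < 1 \<and> x /\<^sub>R norm x \<in> A}"
      by eventually_elim auto
  qed (auto intro!: cone_measurable[OF A])
  finally show ?thesis .
qed

text \<open>For \<open>y = c ^ n\<close> the set is the dilate by \<open>c\<close> of the unit
  sector over \<open>A\<close>, and dilation multiplies volume by \<open>c ^ n\<close>. For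
  \<open>y = 0\<close> both sides vanish.\<close>

lemma emeasure_truncated_cone:
  fixes A :: "(real ^ 'n) set"
  assumes A: "A \<in> sets cone_measure" and y: "y < top"
  shows "emeasure lborel {x. x \<noteq> 0 \<and> ennreal (norm x ^ CARD('n)) < y \<and> x /\<^sub>R norm x \<in> A}
     = y * emeasure cone_measure A"
proof (cases "y = 0")
  case False
  with y obtain r where r: "y = ennreal r" "0 < r"
    by (cases y) (auto simp: ennreal_eq_0_iff not_le)
  define c where "c = root CARD('n) r"
  have c: "0 < c" "c ^ CARD('n) = r" using r by (auto simp: c_def)
  let ?C = "{x. x \<noteq> 0 \<and> norm x < 1 \<and> x /\<^sub>R norm x \<in> A}"
  have lt: "ennreal (norm x ^ CARD('n)) < y \<longleftrightarrow> norm x < c" for x :: "real ^ 'n"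
  proof -
    have "ennreal (norm x ^ CARD('n)) < y \<longleftrightarrow> norm x ^ CARD('n) < c ^ CARD('n)"
      by (simp add: r c ennreal_less_iff)
    also have "\<dots> \<longleftrightarrow> norm x < c"
      using c by (metis norm_ge_zero power_less_imp_less_base power_strict_mono less_imp_le zero_less_card_finite)
    finally show ?thesis .
  qed
  have normalize: "inverse c * inverse t * c = inverse t" for t using c(1) by simp
  have "{x. x \<noteq> 0 \<and> ennreal (norm x ^ CARD('n)) < y \<and> x /\<^sub>R norm x \<in> A} = (\<lambda>x. c *\<^sub>R x) ` ?C"
  proof (intro set_eqI iffI)
    fix x assume x: "x \<in> {x. x \<noteq> 0 \<and> ennreal (norm x ^ CARD('n)) < y \<and> x /\<^sub>R norm x \<in> A}"
    then have "x /\<^sub>R c \<in> ?C" using c(1) by (auto simp: lt field_simps)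
    then show "x \<in> (\<lambda>x. c *\<^sub>R x) ` ?C" using c(1) by (intro image_eqI[of _ _ "x /\<^sub>R c"]) auto
  next
    fix x assume "x \<in> (\<lambda>x. c *\<^sub>R x) ` ?C"
    then show "x \<in> {x. x \<noteq> 0 \<and> ennreal (norm x ^ CARD('n)) < y \<and> x /\<^sub>R norm x \<in> A}"
      using c(1) by (auto simp: lt normalize)
  qed
  then show ?thesis
    using emeasure_lborel_scaleR_image(2)[OF cone_measurable[OF A, of "\<lambda>t. t < 1"] c(1)] c(2) r(1)
    by (simp add: emeasure_cone_measure[OF A])
qed simp

lemma truncated_cone_sets:
  fixes A :: "(real ^ 'n) set"
  assumes A: "A \<in> sets cone_measure"
  shows "{x. x \<noteq> 0 \<and> ennreal (norm x ^ CARD('n)) < y \<and> x /\<^sub>R norm x \<in> A} \<in> sets borel"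
  using cone_measurable[OF A, of "\<lambda>t. ennreal (t ^ CARD('n)) < y"] by simp

text \<open>The strict inequality makes the region below the graph of \<open>g\<close> commute with increasing
  suprema, so that simple functions suffice.\<close>

lemma emeasure_radial_region_simple:
  fixes g :: "real ^ 'n \<Rightarrow> ennreal"
  assumes g: "simple_function cone_measure g" "\<And>x. g x < top"
  shows "{x. x \<noteq> 0 \<and> ennreal (norm x ^ CARD('n)) < g (x /\<^sub>R norm x)} \<in> sets borel" (is "?U \<in> _")
    and "emeasure lborel {x. x \<noteq> 0 \<and> ennreal (norm x ^ CARD('n)) < g (x /\<^sub>R norm x)}
      = (\<integral>\<^sup>+ u. g u \<partial>cone_measure)"
proof -
  let ?A = "\<lambda>y. g -` {y} \<inter> space cone_measure"
  let ?C = "\<lambda>y. {x. x \<noteq> 0 \<and> ennreal (norm x ^ CARD('n)) < y \<and> x /\<^sub>R norm x \<in> ?A y}"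
  have A: "?A y \<in> sets cone_measure" for y using g(1) by (rule simple_functionD)
  have fin: "finite (g ` space cone_measure)" using g(1) by (rule simple_functionD)
  have sets: "?C y \<in> sets borel" for y using truncated_cone_sets[OF A] .
  \<comment> \<open>Grouping directions by the value of \<open>g\<close> cuts the region into
    finitely many truncated cones, disjoint because each nonzero point has one direction.\<close>
  have U: "?U = (\<Union>y\<in>g ` space cone_measure. ?C y)" 
  proof (intro equalityI subsetI)
    fix x assume x: "x \<in> ?U"
    then have "x /\<^sub>R norm x \<in> space cone_measure" by (simp add: space_cone_measure)
    with x show "x \<in> (\<Union>y\<in>g ` space cone_measure. ?C y)"
      by (intro UN_I[of "g (x /\<^sub>R norm x)"] imageI CollectI conjI IntI vimageI2) (auto simp only: mem_Collect_eq singleton_iff)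
  qed auto
  show "?U \<in> sets borel" unfolding U by (intro sets.finite_UN fin sets)
  have "emeasure lborel ?U = (\<Sum>y\<in>g ` space cone_measure. emeasure lborel (?C y))"
    unfolding U
  proof (rule sum_emeasure[symmetric])
    show "?C ` g ` space cone_measure \<subseteq> sets lborel"
      unfolding sets_lborel by (rule image_subsetI) (rule sets)
    show "disjoint_family_on ?C (g ` space cone_measure)"
      unfolding disjoint_family_on_def by (intro ballI impI) auto
  qed (rule fin)
  also have "\<dots> = (\<Sum>y\<in>g ` space cone_measure. y * emeasure cone_measure (?A y))"
    using g(2) by (intro sum.cong refl emeasure_truncated_cone[OF A]) auto
  also have "\<dots> = (\<integral>\<^sup>+ u. g u \<partial>cone_measure)"
    using nn_integral_eq_simple_integral[OF g(1)] by (simp add: simple_integral_def)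
  finally show "emeasure lborel ?U = (\<integral>\<^sup>+ u. g u \<partial>cone_measure)" .
qed

text \<open>Both sides are continuous along increasing sequences of simple functions: Lebesgue
  measure by continuity from below, the integral by monotone convergence.\<close>

lemma emeasure_radial_region:
  fixes g :: "real ^ 'n \<Rightarrow> ennreal"
  assumes g: "g \<in> borel_measurable cone_measure"
  shows "{x. x \<noteq> 0 \<and> ennreal (norm x ^ CARD('n)) < g (x /\<^sub>R norm x)} \<in> sets borel" (is "?U \<in> _")
    and "emeasure lborel {x. x \<noteq> 0 \<and> ennreal (norm x ^ CARD('n)) < g (x /\<^sub>R norm x)}
      = (\<integral>\<^sup>+ u. g u \<partial>cone_measure)"
proof -
  obtain f where f: "\<And>i. simple_function cone_measure (f i)" "incseq f" "\<And>i x. f i x < top"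
      "\<And>x. (SUP i. f i x) = g x"
    using borel_measurable_implies_simple_function_sequence'[OF g] by blast
  let ?V = "\<lambda>i. {x. x \<noteq> 0 \<and> ennreal (norm x ^ CARD('n)) < f i (x /\<^sub>R norm x)}"
  note V = emeasure_radial_region_simple[OF f(1,3)]
  have U: "?U = (\<Union>i. ?V i)" by (auto simp: f(4)[symmetric] less_SUP_iff)
  show "?U \<in> sets borel" unfolding U using V(1) by blast
  have "incseq ?V"
    using f(2) by (auto simp: incseq_def le_fun_def intro: less_le_trans)
  then have "emeasure lborel ?U = (SUP i. emeasure lborel (?V i))"
    unfolding U using V(1) by (intro SUP_emeasure_incseq[symmetric]) auto
  also have "\<dots> = (SUP i. \<integral>\<^sup>+ u. f i u \<partial>cone_measure)" using V(2) by simp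
  also have "\<dots> = (\<integral>\<^sup>+ u. (SUP i. f i u) \<partial>cone_measure)"
    using f(1,2) by (intro nn_integral_monotone_convergence_SUP[symmetric]) (auto intro: borel_measurable_simple_function)
  finally show "emeasure lborel ?U = (\<integral>\<^sup>+ u. g u \<partial>cone_measure)" by (simp add: f(4))
qed

text \<open>Taking \<open>g = \<rho>^n\<close> in the region formula gives the volume of the points
  strictly inside \<open>L\<close> on their rays. What is left is to show that the radial boundary
  has no volume.\<close>

lemma emeasure_star_neighbourhood:
  fixes L :: "(real ^ 'n) set"
  assumes L: "star_neighbourhood L"
  shows "emeasure lborel L = (\<integral>\<^sup>+ u. ennreal (radial L u ^ CARD('n)) \<partial>cone_measure)"
proof -
  let ?g = "\<lambda>u. ennreal (radial L u ^ CARD('n))"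
  define U where "U = {x. x \<noteq> 0 \<and> ennreal (norm x ^ CARD('n)) < ?g (x /\<^sub>R norm x)}"
  have [measurable]: "radial L \<in> borel_measurable cone_measure"
    using borel_measurable_radial[OF L] by (simp cong: measurable_cong_sets add: sets_cone_measure)
  have U: "U \<in> sets borel" "emeasure lborel U = (\<integral>\<^sup>+ u. ?g u \<partial>cone_measure)"
    unfolding U_def by (rule emeasure_radial_region; measurable)+
  have mem_U: "x \<in> U \<longleftrightarrow> x \<noteq> 0 \<and> norm x < radial L (x /\<^sub>R norm x)" for x
  proof (cases "x = 0")
    case False
    then have "0 < radial L (x /\<^sub>R norm x)" using radial_pos[OF L] by simp
    then show ?thesis
      unfolding U_def
      by (auto simp: ennreal_less_iff intro!: power_strict_mono dest: power_less_imp_less_base)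
  qed (simp add: U_def)
  have compL: "compact L" using L by (simp add: star_neighbourhood_def)
  have "U \<subseteq> L" using mem_iff_norm_le_radial[OF L] by (auto simp: mem_U)
  have fmL: "L \<in> fmeasurable lborel" using compL by (rule fmeasurable_compact)
  have fmU: "U \<in> fmeasurable lborel" using fmeasurableI2[OF fmL \<open>U \<subseteq> L\<close>] U(1) by simp
  \<comment> \<open>\<open>L\<close> and its radial interior \<open>U\<close> differ by a null set, because \<open>L\<close> lies in every dilate \<open>r U\<close> with \<open>r > 1\<close>.\<close>
  have ge: "measure lborel L \<le> r ^ CARD('n) * measure lborel U" if r: "1 < r" for r :: real
  proof -
    let ?rU = "(\<lambda>x. r *\<^sub>R x) ` U"
    have rU: "?rU \<in> sets borel" "emeasure lborel ?rU = ennreal (r ^ CARD('n)) * emeasure lborel U"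
      using emeasure_lborel_scaleR_image[OF U(1), of r] r by auto
    \<comment> \<open>The origin has no direction, so it is missing from \<open>U\<close> and has to
      be added back; a single point does not change the volume.\<close>
    have sub: "L \<subseteq> insert 0 ?rU"
    proof
      fix x assume "x \<in> L"
      show "x \<in> insert 0 ?rU"
      proof (cases "x = 0")
        case False
        with \<open>x \<in> L\<close> have "norm x \<le> radial L (x /\<^sub>R norm x)" using mem_iff_norm_le_radial[OF L] by auto
        moreover have "norm x / r < norm x" using r False by (simp add: field_simps)
        ultimately have "norm x / r < radial L (x /\<^sub>R norm x)" by simp
        moreover have "(x /\<^sub>R r) /\<^sub>R norm (x /\<^sub>R r) = x /\<^sub>R norm x" using r by simp
        moreover have "norm (x /\<^sub>R r) = norm x / r" using r by (simp add: divide_inverse_commute)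
        ultimately have "x /\<^sub>R r \<in> U" using r False unfolding mem_U by (metis scaleR_eq_0_iff inverse_nonzero_iff_nonzero not_one_less_zero)
        then show ?thesis using r by (intro insertI2 image_eqI[of _ _ "x /\<^sub>R r"]) auto
      qed simp
    qed
    have "emeasure lborel L \<le> emeasure lborel (insert 0 ?rU)"
      using sub rU(1) by (intro emeasure_mono) auto
    also have "\<dots> = emeasure lborel ?rU"
      using rU(1) by (subst insert_is_Un, subst Un_commute, intro emeasure_Un_null_set) auto
    finally show ?thesis
      using fmL fmU r unfolding rU(2)
      by (simp add: emeasure_eq_measure2 ennreal_mult[symmetric])
  qed
  have "((\<lambda>r. r ^ CARD('n) * measure lborel U) \<longlongrightarrow> 1 ^ CARD('n) * measure lborel U) (at_right 1)"
    by (intro tendsto_intros)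
  then have "measure lborel L \<le> 1 ^ CARD('n) * measure lborel U"
    by (rule tendsto_lowerbound) (use ge in \<open>auto simp: eventually_at_right_less eventually_at_filter\<close>)
  then have "emeasure lborel L \<le> emeasure lborel U"
    using fmL fmU by (simp add: emeasure_eq_measure2)
  moreover have "emeasure lborel U \<le> emeasure lborel L"
    using \<open>U \<subseteq> L\<close> fmL by (intro emeasure_mono) auto
  ultimately show ?thesis using U(2) by simp
qed

lemma spherical_measure_eq: "spherical_measure = scale_measure (of_nat CARD('n)) (cone_measure :: (real ^ 'n) measure)"
  unfolding spherical_measure_def cone_measure_def ..

lemma sets_spherical_measure [measurable_cong]:
  "sets spherical_measure = sets (restrict_space borel (sphere 0 1))"
  and space_spherical_measure: "space spherical_measure = sphere 0 1"
  by (simp_all add: spherical_measure_eq sets_cone_measure space_scale_measure space_cone_measure)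

lemma nn_integral_radial_spherical:
  fixes L :: "(real ^ 'n) set"
  assumes L: "star_neighbourhood L"
  shows "(\<integral>\<^sup>+ u. ennreal (radial L u ^ CARD('n)) \<partial>spherical_measure) = ennreal (real CARD('n) * measure lborel L)"
proof -
  have [measurable]: "radial L \<in> borel_measurable cone_measure"
    using borel_measurable_radial[OF L] by (simp cong: measurable_cong_sets add: sets_cone_measure)
  have "L \<in> fmeasurable lborel" using L by (intro fmeasurable_compact) (simp add: star_neighbourhood_def)
  then show ?thesis
    unfolding spherical_measure_eq
    by (simp add: nn_integral_scale_measure emeasure_star_neighbourhood[OF L, symmetric]
        emeasure_eq_measure2 ennreal_mult ennreal_of_nat_eq_real_of_nat)
qed

section \<open>Means of radial quotients\<close>

text \<open>For a star neighbourhood \<open>K\<close> this is the distribution of the direction of a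
  uniformly random point of \<open>K\<close>.\<close>

definition dual_cone_probability :: "(real ^ 'n) set \<Rightarrow> (real ^ 'n) measure" where
  "dual_cone_probability K =
     density spherical_measure (\<lambda>u. ennreal (radial K u ^ CARD('n) / (real CARD('n) * measure lborel K)))"

definition mean_radial_quotient ::
    "(real ^ 'n) set \<Rightarrow> (real \<Rightarrow> real) \<Rightarrow> (real ^ 'n) set \<Rightarrow> real" where
  "mean_radial_quotient K f L = (LINT u|dual_cone_probability K. f (radial L u / radial K u))"

lemma borel_measurable_radial_spherical [measurable]:
  "star_neighbourhood L \<Longrightarrow> radial L \<in> borel_measurable (spherical_measure :: (real ^ 'n) measure)"
  using borel_measurable_radial by (simp cong: measurable_cong_sets add: sets_spherical_measure)

lemma convex_image_Ioi: "continuous_on {0<..} f \<Longrightarrow> convex (f ` {0::real<..} :: real set)"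
  by (simp add: is_interval_convex_1[symmetric] is_interval_connected_1 connected_continuous_image)

context
  fixes K :: "(real ^ 'n) set"
  assumes K: "star_neighbourhood K"
begin

lemma normalising_constant_pos: "0 < real CARD('n) * measure lborel K"
  using measure_star_neighbourhood_pos[OF K] by simp

lemma prob_space_dual_cone: "prob_space (dual_cone_probability K)"
proof
  note [measurable] = borel_measurable_radial_spherical[OF K]
  let ?c = "real CARD('n) * measure lborel K"
  have "emeasure (dual_cone_probability K) (space (dual_cone_probability K))
      = (\<integral>\<^sup>+ u. ennreal (radial K u ^ CARD('n) / ?c) \<partial>spherical_measure)"
    unfolding dual_cone_probability_def by (subst emeasure_density) (auto intro!: nn_integral_cong)
  also have "\<dots> = (\<integral>\<^sup>+ u. ennreal (1 / ?c) * ennreal (radial K u ^ CARD('n)) \<partial>spherical_measure)"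
    using normalising_constant_pos radial_pos[OF K]
    by (intro nn_integral_cong) (auto simp: ennreal_mult[symmetric] less_imp_le space_spherical_measure)
  also have "\<dots> = ennreal (1 / ?c) * ennreal ?c"
    by (simp add: nn_integral_cmult nn_integral_radial_spherical[OF K])
  also have "\<dots> = 1" using normalising_constant_pos
    by (subst ennreal_mult[symmetric]) (auto intro: less_imp_le)
  finally show "emeasure (dual_cone_probability K) (space (dual_cone_probability K)) = 1" .
qed

lemma space_dual_cone: "space (dual_cone_probability K) = sphere 0 1"
  and sets_dual_cone: "sets (dual_cone_probability K) = sets spherical_measure"
  by (simp_all add: dual_cone_probability_def space_spherical_measure)

lemma dual_mixed_volume_eq_expectation:
  assumes f: "(\<lambda>u. \<phi> (radial L u / radial K u)) \<in> borel_measurable spherical_measure"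
  shows "real CARD('n) * dual_mixed_volume \<phi> K L / (real CARD('n) * measure lborel K)
    = (LINT u|dual_cone_probability K. \<phi> (radial L u / radial K u))"
proof -
  note [measurable] = borel_measurable_radial_spherical[OF K] f
  let ?c = "real CARD('n) * measure lborel K"
  have "(LINT u|dual_cone_probability K. \<phi> (radial L u / radial K u))
     = (LINT u|spherical_measure. (radial K u ^ CARD('n) / ?c) *\<^sub>R \<phi> (radial L u / radial K u))"
    unfolding dual_cone_probability_def
    using normalising_constant_pos radial_pos[OF K]
    by (intro integral_density) (auto simp: space_spherical_measure less_imp_le intro!: AE_I2)
  also have "\<dots> = (LINT u|spherical_measure. (\<phi> (radial L u / radial K u) * radial K u ^ CARD('n)) / ?c)"
    by (simp add: mult.commute)
  also have "\<dots> = (LINT u|spherical_measure. \<phi> (radial L u / radial K u) * radial K u ^ CARD('n)) / ?c"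
    by (rule integral_divide_zero)
  finally show ?thesis by (simp add: dual_mixed_volume_def)
qed

text \<open>An Orlicz function may blow up at 0 or at infinity. The quotients stay in a compact
  subinterval of the positive reals, on which every continuous function is bounded.\<close>

lemma radial_quotient_bounds:
  assumes L: "star_neighbourhood L"
  obtains a b where "0 < a" "\<And>u. u \<in> sphere 0 1 \<Longrightarrow> radial L u / radial K u \<in> {a..b}"
proof -
  obtain r R where r: "0 < r" "\<And>u. u \<in> sphere 0 1 \<Longrightarrow> r \<le> radial L u \<and> radial L u \<le> R"
    using radial_bounds[OF L] by metis
  obtain s S where s: "0 < s" "\<And>u. u \<in> sphere 0 1 \<Longrightarrow> s \<le> radial K u \<and> radial K u \<le> S"
    using radial_bounds[OF K] by metis
  obtain u0 :: "real ^ 'n" where "u0 \<in> sphere 0 1" using vector_choose_size[of 1] by auto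
  then have "0 < S" "0 < R" using s r by force+
  have "radial L u / radial K u \<in> {r / S..R / s}" if u: "u \<in> sphere 0 1" for u
    using r(1) r(2)[OF u] s(1) s(2)[OF u] \<open>0 < R\<close> by (auto intro!: frac_le)
  then show ?thesis using that[of "r / S"] r \<open>0 < S\<close> by auto
qed

lemma continuous_radial_quotient:
  assumes L: "star_neighbourhood L" and f: "continuous_on {0<..} f"
  shows borel_measurable_radial_quotient:
      "(\<lambda>u. f (radial L u / radial K u) :: real) \<in> borel_measurable spherical_measure"
    and integrable_radial_quotient:
      "integrable (dual_cone_probability K) (\<lambda>u. f (radial L u / radial K u))"
proof -
  note [measurable] = borel_measurable_radial_spherical[OF K] borel_measurable_radial_spherical[OF L]
  interpret prob_space "dual_cone_probability K" by (rule prob_space_dual_cone)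
  obtain a b where ab: "0 < a" "\<And>u. u \<in> sphere 0 1 \<Longrightarrow> radial L u / radial K u \<in> {a..b}"
    using radial_quotient_bounds[OF L] by metis
  show meas: "(\<lambda>u. f (radial L u / radial K u)) \<in> borel_measurable spherical_measure"
  proof -
    \<comment> \<open>Continuity of \<open>f\<close> is known only on the positive reals, so the
      composition is routed through that subspace.\<close>
    have "(\<lambda>u. radial L u / radial K u) \<in> measurable spherical_measure (restrict_space borel {0<..})"
      using radial_pos[OF K] radial_pos[OF L]
      by (intro measurable_restrict_space2) (auto simp: space_spherical_measure)
    then show ?thesis
      by (rule measurable_compose) (rule borel_measurable_continuous_on_restrict[OF f])
  qed
  have "compact (f ` {a..b})"
    using ab(1) by (intro compact_continuous_image continuous_on_subset[OF f]) auto
  then obtain B where B: "\<And>x. x \<in> {a..b} \<Longrightarrow> norm (f x) \<le> B"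
    by (meson bounded_iff compact_imp_bounded imageI)
  show "integrable (dual_cone_probability K) (\<lambda>u. f (radial L u / radial K u))"
  proof (rule integrable_const_bound)
    show "AE u in dual_cone_probability K. norm (f (radial L u / radial K u)) \<le> B"
      using B ab by (intro AE_I2) (simp add: space_dual_cone)
    show "random_variable borel (\<lambda>u. f (radial L u / radial K u))"
      using meas by (simp cong: measurable_cong_sets add: sets_dual_cone)
  qed
qed

lemma mean_radial_quotient_const:
  assumes L: "star_neighbourhood L" and "\<And>t. 0 < t \<Longrightarrow> f t = c"
  shows "mean_radial_quotient K f L = c"
proof -
  interpret prob_space "dual_cone_probability K" by (rule prob_space_dual_cone)
  have "mean_radial_quotient K f L = (LINT u|dual_cone_probability K. c)"
    unfolding mean_radial_quotient_def using assms(2) radial_pos[OF K] radial_pos[OF L]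
    by (intro Bochner_Integration.integral_cong) (auto simp: space_dual_cone)
  then show ?thesis by (simp add: prob_space)
qed

lemma mean_radial_quotient_dilate:
  assumes "0 < c"
  shows "mean_radial_quotient K f ((\<lambda>x. c *\<^sub>R x) ` K) = f c"
proof -
  interpret prob_space "dual_cone_probability K" by (rule prob_space_dual_cone)
  have "mean_radial_quotient K f ((\<lambda>x. c *\<^sub>R x) ` K) = (LINT u|dual_cone_probability K. f c)"
    unfolding mean_radial_quotient_def
  proof (intro Bochner_Integration.integral_cong refl)
    fix u assume "u \<in> space (dual_cone_probability K)"
    then have u: "u \<in> sphere 0 1" by (simp add: space_dual_cone)
    show "f (radial ((\<lambda>x. c *\<^sub>R x) ` K) u / radial K u) = f c"
      using radial_scaled[OF K assms u] radial_pos[OF K u] by simp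
  qed
  then show ?thesis by (simp add: prob_space)
qed

text \<open>The bounds are attained values of \<open>f\<close> and hence lie in its range. Arbitrary
  bounds would not do, since the range may be a proper subinterval on which alone \<open>H\<close>
  is controlled.\<close>

lemma continuous_radial_quotient_bounds:
  assumes L: "star_neighbourhood L" and f: "continuous_on {0<..} f"
  obtains p q where "p \<in> f ` {0<..}" "q \<in> f ` {0<..}"
    "\<And>u. u \<in> sphere 0 1 \<Longrightarrow> f (radial L u / radial K u) \<in> {p..q :: real}"
proof -
  obtain a b where ab: "0 < a" "\<And>u. u \<in> sphere 0 1 \<Longrightarrow> radial L u / radial K u \<in> {a..b}"
    using radial_quotient_bounds[OF L] by metis
  obtain u0 :: "real ^ 'n" where "u0 \<in> sphere 0 1" using vector_choose_size[of 1] by auto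
  then have "{a..b} \<noteq> {}" using ab(2) by blast
  moreover have "continuous_on {a..b} f" using ab(1) by (intro continuous_on_subset[OF f]) auto
  ultimately obtain x y where "x \<in> {a..b}" "\<And>t. t \<in> {a..b} \<Longrightarrow> f x \<le> f t"
    and "y \<in> {a..b}" "\<And>t. t \<in> {a..b} \<Longrightarrow> f t \<le> f y"
    using continuous_attains_inf[of "{a..b}" f] continuous_attains_sup[of "{a..b}" f] by blast
  with ab show ?thesis using that[of "f x" "f y"] by auto
qed

text \<open>The mean lies between two values of \<open>f\<close>, and the range of \<open>f\<close>
  is an interval. This allows \<open>H\<close> itself, without any limit, to be applied to the mean
  of a single competitor.\<close>

lemma mean_radial_quotient_in_range:
  assumes L: "star_neighbourhood L" and f: "continuous_on {0<..} f"
  shows "mean_radial_quotient K f L \<in> f ` {0<..}"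
proof -
  interpret prob_space "dual_cone_probability K" by (rule prob_space_dual_cone)
  obtain p q where pq: "p \<in> f ` {0<..}" "q \<in> f ` {0<..}"
      "\<And>u. u \<in> sphere 0 1 \<Longrightarrow> f (radial L u / radial K u) \<in> {p..q}"
    using continuous_radial_quotient_bounds[OF L f] by metis
  have "p \<le> mean_radial_quotient K f L"
    unfolding mean_radial_quotient_def using pq(3)
    by (intro integral_ge_const integrable_radial_quotient[OF L f] AE_I2) (auto simp: space_dual_cone)
  moreover have "mean_radial_quotient K f L \<le> q"
    unfolding mean_radial_quotient_def using pq(3)
    by (intro integral_le_const integrable_radial_quotient[OF L f] AE_I2) (auto simp: space_dual_cone)
  ultimately show ?thesis
    using convex_image_Ioi[OF f] pq(1,2)
    by (auto simp: is_interval_convex_1[symmetric] intro: mem_is_interval_1_I)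
qed

text \<open>To be used with \<open>f = \<psi>\<close>, \<open>g = \<phi>\<close> and
  \<open>h = H\<close>, so that \<open>h\<close> composed with \<open>f\<close> is \<open>g\<close>
  on the positive reals.\<close>

lemma jensen_radial_quotient:
  assumes L: "star_neighbourhood L" and f: "continuous_on {0<..} f" and g: "continuous_on {0<..} g"
    and D: "D = f ` {0<..}" "open D" and h: "convex_on D h" "\<And>t. 0 < t \<Longrightarrow> h (f t) = g t"
  shows "h (mean_radial_quotient K f L) \<le> mean_radial_quotient K g L"
proof -
  interpret prob_space "dual_cone_probability K" by (rule prob_space_dual_cone)
  have hf: "h (f (radial L u / radial K u)) = g (radial L u / radial K u)" if "u \<in> sphere 0 1" for u
    using that radial_pos[OF K] radial_pos[OF L] by (intro h) simp
  obtain p q where pq: "p \<in> D" "q \<in> D"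
      "\<And>u. u \<in> sphere 0 1 \<Longrightarrow> f (radial L u / radial K u) \<in> {p..q}"
    using continuous_radial_quotient_bounds[OF L f] unfolding D(1) by metis
  \<comment> \<open>The values fill at most the closed interval from \<open>p\<close> to
    \<open>q\<close>, while Jensen's inequality is applied on an open interval. Openness of
    \<open>D\<close> leaves room to move both ends outwards without leaving
    \<open>D\<close>.\<close>
  obtain e where e: "0 < e" "cball p e \<subseteq> D" using D(2) pq(1) open_contains_cball by metis
  obtain d where d: "0 < d" "cball q d \<subseteq> D" using D(2) pq(2) open_contains_cball by metis
  let ?I = "{p - e <..< q + d}"
  have ends: "p - e \<in> D" "q + d \<in> D" using e d by (auto simp: dist_real_def subset_iff)
  have "is_interval D" using convex_image_Ioi[OF f] by (simp add: D(1) is_interval_convex_1)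
  from mem_is_interval_1_I[OF this ends] have I: "?I \<subseteq> D" by auto
  have "h (expectation (\<lambda>u. f (radial L u / radial K u)))
      \<le> expectation (\<lambda>u. h (f (radial L u / radial K u)))"
  proof (rule jensens_inequality)
    show "integrable (dual_cone_probability K) (\<lambda>u. f (radial L u / radial K u))"
      by (rule integrable_radial_quotient[OF L f])
    show "AE u in dual_cone_probability K. f (radial L u / radial K u) \<in> ?I"
      using pq(3) e(1) d(1) by (intro AE_I2) (force simp: space_dual_cone)
    show "?I = {p - e <..< q + d} \<or> ?I = {p - e <..} \<or> ?I = {..< q + d} \<or> ?I = UNIV" by simp
    show "integrable (dual_cone_probability K) (\<lambda>u. h (f (radial L u / radial K u)))"
      using integrable_radial_quotient[OF L g]
      by (rule Bochner_Integration.integrable_cong[OF refl, THEN iffD1, rotated])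
        (simp add: space_dual_cone hf)
    show "convex_on ?I h" using h(1) I by (rule convex_on_subset) simp
  qed
  also have "\<dots> = mean_radial_quotient K g L"
    unfolding mean_radial_quotient_def
    by (intro Bochner_Integration.integral_cong refl hf) (simp add: space_dual_cone)
  finally show ?thesis by (simp add: mean_radial_quotient_def)
qed

lemma jensen_radial_quotient_concave:
  assumes L: "star_neighbourhood L" and f: "continuous_on {0<..} f" and g: "continuous_on {0<..} g"
    and D: "D = f ` {0<..}" "open D" and h: "concave_on D h" "\<And>t. 0 < t \<Longrightarrow> h (f t) = g t"
  shows "mean_radial_quotient K g L \<le> h (mean_radial_quotient K f L)"
  using jensen_radial_quotient[OF L f _ D, of "\<lambda>t. - g t" "\<lambda>t. - h t"] g h
  by (simp add: mean_radial_quotient_def concave_on_def continuous_on_minus)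

end

section \<open>Dual Orlicz surface areas\<close>

text \<open>\<open>orlicz_extremum\<close> tests membership in \<open>Phi_tilde\<close> alone, so
  the overlap of the two classes must be understood before a supremum can be claimed for
  \<open>Psi_tilde\<close>. Strict convexity and strict concavity contradict each other at any
  midpoint; 1 and 2 serve as endpoints.\<close>

lemma Phi_Psi_constant:
  assumes "0 < n" "\<phi> \<in> Phi_tilde n" "\<phi> \<in> Psi_tilde n"
  shows "\<exists>c. \<forall>t>0. \<phi> t = c"
proof -
  let ?F = "\<lambda>t. \<phi> (t powr (1 / real n))"
  have "\<not> (strictly_convex_on {0<..} ?F \<and> strictly_concave_on {0<..} ?F)"
  proof
    assume *: "strictly_convex_on {0<..} ?F \<and> strictly_concave_on {0<..} ?F"
    have mid: "f (1/2 * 1 + 1/2 * 2) < 1/2 * f 1 + 1/2 * f 2" if "strictly_convex_on {0<..} f" for f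
      using that unfolding strictly_convex_on_def
      by (elim conjE, elim ballE[of _ _ 1] ballE[of _ _ 2] allE[of _ "1/2"] impE) auto
    have "?F (1/2 * 1 + 1/2 * 2) < 1/2 * ?F 1 + 1/2 * ?F 2"
      using mid[of ?F] * by blast
    moreover have "- ?F (1/2 * 1 + 1/2 * 2) < 1/2 * (- ?F 1) + 1/2 * (- ?F 2)"
      using mid[of "\<lambda>t. - ?F t"] * unfolding strictly_concave_on_def by blast
    ultimately show False by simp
  qed
  then obtain c where c: "\<And>t. 0 < t \<Longrightarrow> ?F t = c"
    using assms(2,3) by (auto simp: Phi_tilde_def Psi_tilde_def Let_def)
  have "\<phi> t = c" if "0 < t" for t
    using c[of "t powr real n"] that assms(1) by (simp add: powr_powr)
  then show ?thesis by blast
qed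

definition normalised_mean :: "(real ^ 'n) set \<Rightarrow> (real \<Rightarrow> real) \<Rightarrow> (real ^ 'n) set \<Rightarrow> real" where
  "normalised_mean K f L = mean_radial_quotient K f ((\<lambda>x. vrad (polar_body L) *\<^sub>R x) ` L)"

lemma star_neighbourhood_normalised:
  "star_neighbourhood L \<Longrightarrow> star_neighbourhood ((\<lambda>x. vrad (polar_body L) *\<^sub>R x) ` L)"
  by (intro star_neighbourhood_scaled vrad_polar_body_pos)

lemma
  fixes K :: "(real ^ 'n) set"
  assumes K: "star_neighbourhood K" and \<L>: "\<And>L. L \<in> \<L> \<Longrightarrow> star_neighbourhood L"
    and \<phi>: "orlicz_function \<phi>"
  shows orlicz_extremum_Phi: "\<phi> \<in> Phi_tilde CARD('n) \<Longrightarrow>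
      orlicz_extremum \<L> \<phi> K / ereal (real CARD('n) * measure lborel K)
        = (INF L\<in>\<L>. ereal (normalised_mean K \<phi> L))"
    and orlicz_extremum_Psi: "\<phi> \<in> Psi_tilde CARD('n) \<Longrightarrow> \<L> \<noteq> {} \<Longrightarrow>
      orlicz_extremum \<L> \<phi> K / ereal (real CARD('n) * measure lborel K)
        = (SUP L\<in>\<L>. ereal (normalised_mean K \<phi> L))"
proof -
  let ?c = "real CARD('n) * measure lborel K"
  let ?V = "\<lambda>L. real CARD('n) * dual_mixed_volume \<phi> K ((\<lambda>x. vrad (polar_body L) *\<^sub>R x) ` L)"
  have c: "0 < ?c" using K by (rule normalising_constant_pos)
  have V: "ereal (?V L) / ereal ?c = ereal (normalised_mean K \<phi> L)" if "L \<in> \<L>" for L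
  proof -
    have "?V L / ?c = normalised_mean K \<phi> L"
      unfolding normalised_mean_def mean_radial_quotient_def
      using \<phi> by (intro dual_mixed_volume_eq_expectation[OF K] borel_measurable_radial_quotient[OF K]
          star_neighbourhood_normalised \<L> that) (simp add: orlicz_function_def)
    then show ?thesis using c by (simp only: ereal_divide less_imp_neq[symmetric] refl if_False)
  qed
  show Phi: "orlicz_extremum \<L> \<phi> K / ereal ?c = (INF L\<in>\<L>. ereal (normalised_mean K \<phi> L))"
    if "\<phi> \<in> Phi_tilde CARD('n)"
  proof -
    have "orlicz_extremum \<L> \<phi> K / ereal ?c = (INF L\<in>\<L>. ereal (?V L) / ereal ?c)"
      using that by (simp only: orlicz_extremum_def Let_def if_True INF_ereal_divide[OF c])
    then show ?thesis using V by (simp cong: INF_cong)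
  qed
  show "orlicz_extremum \<L> \<phi> K / ereal ?c = (SUP L\<in>\<L>. ereal (normalised_mean K \<phi> L))"
    if Psi: "\<phi> \<in> Psi_tilde CARD('n)" and ne: "\<L> \<noteq> {}"
  proof (cases "\<phi> \<in> Phi_tilde CARD('n)")
    \<comment> \<open>The definition takes the infimum here. As \<open>\<phi>\<close> is constant,
      all means agree, and over a nonempty family supremum and infimum coincide.\<close>
    case True
    then obtain b where b: "\<And>t. 0 < t \<Longrightarrow> \<phi> t = b"
      using Phi_Psi_constant[OF _ True Psi] by auto
    have "normalised_mean K \<phi> L = b" if "L \<in> \<L>" for L
      unfolding normalised_mean_def
      by (rule mean_radial_quotient_const[OF K star_neighbourhood_normalised[OF \<L>[OF that]] b])
    with ne show ?thesis unfolding Phi[OF True] by (simp cong: INF_cong SUP_cong)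
  next
    case False
    then have "orlicz_extremum \<L> \<phi> K / ereal ?c = (SUP L\<in>\<L>. ereal (?V L) / ereal ?c)"
      by (simp only: orlicz_extremum_def Let_def if_False SUP_ereal_divide[OF c])
    then show ?thesis using V by (simp cong: SUP_cong)
  qed
qed

section \<open>The unit ball as a competitor\<close>

lemma polar_body_unit_ball: "polar_body (cball 0 1) = (cball 0 1 :: (real ^ 'n) set)"
proof (intro set_eqI iffI)
  fix y :: "real ^ 'n" assume y: "y \<in> polar_body (cball 0 1)"
  show "y \<in> cball 0 1"
  proof (cases "y = 0")
    case False
    then have "y /\<^sub>R norm y \<in> cball 0 1" by simp
    then have "(y /\<^sub>R norm y) \<bullet> y \<le> 1" using y unfolding polar_body_def by blast
    with False show ?thesis by (simp add: dot_square_norm power2_eq_square field_simps)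
  qed simp
next
  fix y :: "real ^ 'n" assume y: "y \<in> cball 0 1"
  have "x \<bullet> y \<le> 1" if "norm x \<le> 1" for x
  proof -
    have "x \<bullet> y \<le> norm x * norm y" by (rule norm_cauchy_schwarz)
    also have "\<dots> \<le> 1 * 1" using that y by (intro mult_mono) auto
    finally show ?thesis by simp
  qed
  then show "y \<in> polar_body (cball 0 1)" by (simp add: polar_body_def)
qed

text \<open>Reflection in the origin preserves both Lebesgue measure and the ball, so the first
  moment equals its own negative.\<close>

lemma centroid_unit_ball: "centroid (cball 0 1 :: (real ^ 'n) set) = 0"
proof -
  let ?f = "\<lambda>x :: real ^ 'n. indicat_real (cball 0 1) x *\<^sub>R x"
  have "lborel = distr (lborel :: (real ^ 'n) measure) borel uminus"
    by (subst lborel_affine[of "-1" 0]) (simp_all add: density_1)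
  then have "(LINT x|lborel. ?f x) = (LINT x|distr lborel borel uminus. ?f x)" by simp
  also have "\<dots> = (LINT x|lborel. ?f (- x))"
    by (rule integral_distr) (auto intro!: borel_measurable_scaleR borel_measurable_indicator simp: borel_closed)
  also have "\<dots> = - (LINT x|lborel. ?f x)"
    by (simp add: indicator_def flip: Bochner_Integration.integral_minus)
  finally have "2 *\<^sub>R (LINT x|lborel. ?f x) = 0" by (simp add: scaleR_2)
  then have "(LINT x|lborel. ?f x) = 0" by (simp only: scaleR_eq_0_iff) simp
  then show ?thesis by (simp add: centroid_def set_lebesgue_integral_def)
qed

lemma unit_ball_convex_body_c: "cball 0 1 \<in> (convex_bodies_c :: (real ^ 'n) set set)"
  by (simp add: convex_bodies_c_def convex_bodies_def centroid_unit_ball)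

lemma unit_ball_K_tilde: "cball 0 1 \<in> (K_tilde :: (real ^ 'n) set set)"
  using unit_ball_convex_body_c by (auto simp: K_tilde_def)

text \<open>Nonempty competitor classes are what place the extrema in the closure of the set of
  means; over an empty class they would be infinite by convention.\<close>

lemma unit_ball_S_tilde: "cball 0 1 \<in> (S_tilde :: (real ^ 'n) set set)"
proof -
  have r: "radial (cball 0 1) u = 1" if "u \<in> sphere 0 1" for u :: "real ^ 'n"
    using that by (intro radial_eqI) auto
  then have "continuous_on (sphere 0 1) (radial (cball (0 :: real ^ 'n) 1))"
    by (subst continuous_on_cong[OF refl, of _ _ "\<lambda>_. 1"]) auto
  moreover have "closed_segment 0 x \<subseteq> cball 0 1" if "x \<in> cball 0 1" for x :: "real ^ 'n"
    using that by (intro closed_segment_subset) auto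
  ultimately have "cball 0 1 \<in> (star_bodies :: (real ^ 'n) set set)"
    using r by (auto simp: star_bodies_def)
  then show ?thesis by (simp add: S_tilde_def polar_body_unit_ball unit_ball_K_tilde)
qed

text \<open>The affine and the geominimal surface area differ only in the class of competitors, so
  the argument is carried out once for an arbitrary nonempty class \<open>\<L>\<close> of star
  neighbourhoods.\<close>

lemma orlicz_extremum_inequalities:
  fixes K :: "(real ^ 'n) set" and \<phi> \<psi> H :: "real \<Rightarrow> real"
  assumes K: "star_neighbourhood K"
    and \<L>: "\<And>L. L \<in> \<L> \<Longrightarrow> star_neighbourhood L" "\<L> \<noteq> {}"
    and \<phi>: "orlicz_function \<phi>" and \<psi>: "orlicz_function \<psi>" and inverse: "inj_on \<psi> {0<..}"
    and D: "D = \<psi> ` {0<..}" and H: "H = \<phi> \<circ> the_inv_into {0<..} \<psi>"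
  defines "Hx \<equiv> limit_extension D H"
    and "E \<equiv> \<lambda>f. orlicz_extremum \<L> f K / ereal (real CARD('n) * measure lborel K)"
    and "\<Phi> \<equiv> Phi_tilde CARD('n)" and "\<Psi> \<equiv> Psi_tilde CARD('n)"
  shows "(\<phi> \<in> \<Phi> \<and> \<psi> \<in> \<Psi> \<and> mono_on D H) \<or> (\<phi> \<in> \<Phi> \<and> \<psi> \<in> \<Phi> \<and> antimono_on D H) \<Longrightarrow>
      K \<in> \<L> \<Longrightarrow> E \<phi> \<le> Hx (E \<psi>)" (is "?ab \<Longrightarrow> _ \<Longrightarrow> _")
    and "\<phi> \<in> \<Psi> \<and> \<psi> \<in> \<Phi> \<and> mono_on D H \<Longrightarrow> K \<in> \<L> \<Longrightarrow> Hx (E \<psi>) \<le> E \<phi>" (is "?c \<Longrightarrow> _ \<Longrightarrow> _")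
    and "concave_on D H \<and> mono_on D H \<and> (\<phi> \<in> \<Phi> \<and> \<psi> \<in> \<Phi> \<or> \<phi> \<in> \<Psi> \<and> \<psi> \<in> \<Psi>) \<Longrightarrow> E \<phi> \<le> Hx (E \<psi>)" (is "?d \<Longrightarrow> _")
    and "(convex_on D H \<and> antimono_on D H \<and> (\<phi> \<in> \<Phi> \<and> \<psi> \<in> \<Psi> \<or> \<phi> \<in> \<Psi> \<and> \<psi> \<in> \<Phi>)) \<or>
      (convex_on D H \<and> mono_on D H \<and> (\<phi> \<in> \<Phi> \<and> \<psi> \<in> \<Phi> \<or> \<phi> \<in> \<Psi> \<and> \<psi> \<in> \<Psi>)) \<Longrightarrow> Hx (E \<psi>) \<le> E \<phi>" (is "?ef \<Longrightarrow> _")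
proof -
  have cont: "continuous_on {0<..} \<phi>" "continuous_on {0<..} \<psi>"
    using \<phi> \<psi> by (simp_all add: orlicz_function_def)
  have convD: "convex D" unfolding D by (rule convex_image_Ioi[OF cont(2)])
  \<comment> \<open>A continuous injective function on an open interval has an open range; this is
    the room that Jensen's inequality needs around the values of \<open>\<psi>\<close>.\<close>
  have openD: "open D" unfolding D by (rule invariance_of_domain[OF cont(2) _ inverse]) simp
  have inv: "the_inv_into {0<..} \<psi> (\<psi> t) = t" if "0 < t" for t
    using inverse that by (simp add: the_inv_into_f_f)
  have H_eq: "H (\<psi> t) = \<phi> t" if "0 < t" for t using inv[OF that] by (simp add: H)
  have contH: "continuous_on D H"
    unfolding H
  proof (rule continuous_on_compose)
    show "continuous_on D (the_inv_into {0<..} \<psi>)"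
      unfolding D using cont(2) inv by (intro continuous_on_inverse_open) auto
    show "continuous_on (the_inv_into {0<..} \<psi> ` D) \<phi>"
      using inv by (intro continuous_on_subset[OF cont(1)]) (auto simp: D)
  qed
  let ?u = "normalised_mean K \<phi>" and ?w = "normalised_mean K \<psi>"
  have w: "?w L \<in> D" if "L \<in> \<L>" for L
    unfolding normalised_mean_def D
    using star_neighbourhood_normalised[OF \<L>(1)[OF that]] cont(2) by (rule mean_radial_quotient_in_range[OF K])
  have \<phi>\<Phi>: "E \<phi> = (INF L\<in>\<L>. ereal (?u L))" if "\<phi> \<in> \<Phi>"
    using orlicz_extremum_Phi[OF K \<L>(1) \<phi>] that by (simp add: E_def \<Phi>_def)
  have \<psi>\<Phi>: "E \<psi> = (INF L\<in>\<L>. ereal (?w L))" if "\<psi> \<in> \<Phi>"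
    using orlicz_extremum_Phi[OF K \<L>(1) \<psi>] that by (simp add: E_def \<Phi>_def)
  have \<phi>\<Psi>: "E \<phi> = (SUP L\<in>\<L>. ereal (?u L))" if "\<phi> \<in> \<Psi>"
    using orlicz_extremum_Psi[OF K \<L>(1) \<phi> _ \<L>(2)] that by (simp add: E_def \<Psi>_def)
  have \<psi>\<Psi>: "E \<psi> = (SUP L\<in>\<L>. ereal (?w L))" if "\<psi> \<in> \<Psi>"
    using orlicz_extremum_Psi[OF K \<L>(1) \<psi> _ \<L>(2)] that by (simp add: E_def \<Psi>_def)
  have same: "?u K = H (?w K)"
    unfolding normalised_mean_def
    by (simp add: mean_radial_quotient_dilate[OF K] vrad_polar_body_pos[OF K] H_eq)
  have concave: "?u L \<le> H (?w L)" if "L \<in> \<L>" "concave_on D H" for L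
    unfolding normalised_mean_def
    by (rule jensen_radial_quotient_concave[OF K star_neighbourhood_normalised[OF \<L>(1)[OF that(1)]]
          cont(2,1) D openD that(2) H_eq])
  have convex: "H (?w L) \<le> ?u L" if "L \<in> \<L>" "convex_on D H" for L
    unfolding normalised_mean_def
    by (rule jensen_radial_quotient[OF K star_neighbourhood_normalised[OF \<L>(1)[OF that(1)]]
          cont(2,1) D openD that(2) H_eq])

  show "E \<phi> \<le> Hx (E \<psi>)" if ?ab "K \<in> \<L>"
    using that(1)
  proof (elim disjE conjE)
    assume *: "\<phi> \<in> \<Phi>" "\<psi> \<in> \<Psi>" "mono_on D H"
    have "E \<phi> \<le> ereal (H (?w K))" unfolding \<phi>\<Phi>[OF *(1)] same[symmetric] using that(2) by (rule INF_lower)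
    also have "\<dots> \<le> Hx (E \<psi>)"
      unfolding \<psi>\<Psi>[OF *(2)] Hx_def using *(3) that(2) 
        by (intro mono_le_limit_extension_SUP[OF convD contH _ \<L>(2) w]) auto
    finally show ?thesis .
  next
    assume *: "\<phi> \<in> \<Phi>" "\<psi> \<in> \<Phi>" "antimono_on D H"
    have "E \<phi> \<le> ereal (H (?w K))" unfolding \<phi>\<Phi>[OF *(1)] same[symmetric] using that(2) by (rule INF_lower)
    also have "\<dots> \<le> Hx (E \<psi>)"
      unfolding \<psi>\<Phi>[OF *(2)] Hx_def using *(3) that(2) 
        by (intro antimono_le_limit_extension_INF[OF convD contH _ \<L>(2) w]) auto
    finally show ?thesis .
  qed

  show "Hx (E \<psi>) \<le> E \<phi>" if ?c "K \<in> \<L>"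
  proof -
    have *: "\<phi> \<in> \<Psi>" "\<psi> \<in> \<Phi>" "mono_on D H" using that(1) by auto
    have "Hx (E \<psi>) \<le> ereal (H (?w K))"
      unfolding \<psi>\<Phi>[OF *(2)] Hx_def using *(3) that(2) 
        by (intro mono_limit_extension_INF_le[OF convD contH _ \<L>(2) w]) auto
    also have "\<dots> \<le> E \<phi>" unfolding \<phi>\<Psi>[OF *(1)] same[symmetric] using that(2) by (rule SUP_upper)
    finally show ?thesis .
  qed

  show "E \<phi> \<le> Hx (E \<psi>)" if ?d
    using that
  proof (elim disjE conjE)
    assume *: "concave_on D H" "mono_on D H" "\<phi> \<in> \<Phi>" "\<psi> \<in> \<Phi>"
    have "E \<phi> \<le> (INF L\<in>\<L>. ereal (H (?w L)))"
      unfolding \<phi>\<Phi>[OF *(3)] using concave *(1) by (intro INF_mono) auto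
    \<comment> \<open>Monotonicity bounds \<open>Hx\<close> at the infimum from above only. The
      lower bound holds because \<open>Hx (E \<psi>)\<close> is a value or a limit of values
      \<open>H (?w L)\<close>.\<close>
    also have "\<dots> \<le> Hx (E \<psi>)"
      unfolding \<psi>\<Phi>[OF *(4)] Hx_def using *(2)
      by (intro limit_extension_closure_ge_INF[OF convD contH _ \<L>(2) w]
          INF_closure_values[OF convD contH _ \<L>(2) w]) auto
    finally show ?thesis .
  next
    assume *: "concave_on D H" "mono_on D H" "\<phi> \<in> \<Psi>" "\<psi> \<in> \<Psi>"
    show ?thesis
      unfolding \<phi>\<Psi>[OF *(3)]
    proof (rule SUP_least)
      fix L assume L: "L \<in> \<L>"
      have "ereal (?u L) \<le> ereal (H (?w L))" using concave[OF L *(1)] by simp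
      also have "\<dots> \<le> Hx (E \<psi>)"
        unfolding \<psi>\<Psi>[OF *(4)] Hx_def using *(2) L 
        by (intro mono_le_limit_extension_SUP[OF convD contH _ \<L>(2) w]) auto
      finally show "ereal (?u L) \<le> Hx (E \<psi>)" .
    qed
  qed

  show "Hx (E \<psi>) \<le> E \<phi>" if ?ef
    using that
  proof (elim disjE conjE)
    assume *: "convex_on D H" "antimono_on D H" "\<phi> \<in> \<Phi>" "\<psi> \<in> \<Psi>"
    show ?thesis
      unfolding \<phi>\<Phi>[OF *(3)]
    proof (rule INF_greatest)
      fix L assume L: "L \<in> \<L>"
      have "Hx (E \<psi>) \<le> ereal (H (?w L))"
        unfolding \<psi>\<Psi>[OF *(4)] Hx_def using *(2) L 
        by (intro antimono_limit_extension_SUP_le[OF convD contH _ \<L>(2) w]) auto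
      also have "\<dots> \<le> ereal (?u L)" using convex[OF L *(1)] by simp
      finally show "Hx (E \<psi>) \<le> ereal (?u L)" .
    qed
  next
    assume *: "convex_on D H" "antimono_on D H" "\<phi> \<in> \<Psi>" "\<psi> \<in> \<Phi>"
    \<comment> \<open>For decreasing \<open>H\<close> the infimum of the means goes with the
      supremum of the values; again approximation by means supplies the bound that monotonicity does
      not.\<close>
    have "Hx (E \<psi>) \<le> (SUP L\<in>\<L>. ereal (H (?w L)))"
      unfolding \<psi>\<Phi>[OF *(4)] Hx_def using *(2)
      by (intro limit_extension_closure_le_SUP[OF convD contH _ \<L>(2) w]
          INF_closure_values[OF convD contH _ \<L>(2) w]) auto
    also have "\<dots> \<le> E \<phi>"
      unfolding \<phi>\<Psi>[OF *(3)] using convex *(1) by (intro SUP_mono) auto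
    finally show ?thesis .
  next
    assume *: "convex_on D H" "mono_on D H" "\<phi> \<in> \<Phi>" "\<psi> \<in> \<Phi>"
    show ?thesis
      unfolding \<phi>\<Phi>[OF *(3)]
    proof (rule INF_greatest)
      fix L assume L: "L \<in> \<L>"
      have "Hx (E \<psi>) \<le> ereal (H (?w L))"
        unfolding \<psi>\<Phi>[OF *(4)] Hx_def using *(2) L 
        by (intro mono_limit_extension_INF_le[OF convD contH _ \<L>(2) w]) auto
      also have "\<dots> \<le> ereal (?u L)" using convex[OF L *(1)] by simp
      finally show "Hx (E \<psi>) \<le> ereal (?u L)" .
    qed
  next
    assume *: "convex_on D H" "mono_on D H" "\<phi> \<in> \<Psi>" "\<psi> \<in> \<Psi>"
    have "Hx (E \<psi>) \<le> (SUP L\<in>\<L>. ereal (H (?w L)))"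
      unfolding \<psi>\<Psi>[OF *(4)] Hx_def using *(2)
      by (intro limit_extension_closure_le_SUP[OF convD contH _ \<L>(2) w]
          SUP_closure_values[OF convD contH _ \<L>(2) w]) auto
    also have "\<dots> \<le> E \<phi>"
      unfolding \<phi>\<Psi>[OF *(3)] using convex *(1) by (intro SUP_mono) auto
    finally show ?thesis .
  qed
qed

lemma star_neighbourhood_S_tilde: "L \<in> S_tilde \<Longrightarrow> star_neighbourhood L"
  by (simp add: S_tilde_def star_neighbourhood_star_body)

lemma star_neighbourhood_K_tilde: "L \<in> K_tilde \<Longrightarrow> star_neighbourhood L"
  by (auto simp: K_tilde_def convex_bodies_c_def convex_bodies_s_def
      intro: star_neighbourhood_convex_body)

theorem theorem4p2:
  fixes K :: "(real ^ 'n) set" and \<phi> \<psi> H :: "real \<Rightarrow> real"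
    and D :: "real set" and Hx :: "ereal \<Rightarrow> ereal" and nK :: ereal
    and \<Phi> \<Psi> :: "(real \<Rightarrow> real) set"
  assumes K: "K \<in> star_bodies"
    and \<phi>: "orlicz_function \<phi>"
    and \<psi>: "orlicz_function \<psi>"
    and inverse: "inj_on \<psi> {0<..}"
    and D: "D = \<psi> ` {0<..}"
    and H: "H = \<phi> \<circ> the_inv_into {0<..} \<psi>"
    and Hx: "Hx = limit_extension D H"
    and nK: "nK = ereal (real CARD('n) * measure lborel K)"
    and \<Phi>: "\<Phi> = Phi_tilde CARD('n)"
    and \<Psi>: "\<Psi> = Psi_tilde CARD('n)"
  shows
    "((\<phi> \<in> \<Phi> \<and> \<psi> \<in> \<Psi> \<and> mono_on D H) \<or>
      (\<phi> \<in> \<Phi> \<and> \<psi> \<in> \<Phi> \<and> antimono_on D H) \<longrightarrow>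
        (K \<in> S_tilde \<longrightarrow> Omega_orlicz \<phi> K / nK \<le> Hx (Omega_orlicz \<psi> K / nK)) \<and>
        (K \<in> K_tilde \<longrightarrow> G_orlicz \<phi> K / nK \<le> Hx (G_orlicz \<psi> K / nK)))
   \<and> (\<phi> \<in> \<Psi> \<and> \<psi> \<in> \<Phi> \<and> mono_on D H \<longrightarrow>
        (K \<in> S_tilde \<longrightarrow> Omega_orlicz \<phi> K / nK \<ge> Hx (Omega_orlicz \<psi> K / nK)) \<and>
        (K \<in> K_tilde \<longrightarrow> G_orlicz \<phi> K / nK \<ge> Hx (G_orlicz \<psi> K / nK)))
   \<and> (concave_on D H \<and> mono_on D H \<and>
      (\<phi> \<in> \<Phi> \<and> \<psi> \<in> \<Phi> \<or> \<phi> \<in> \<Psi> \<and> \<psi> \<in> \<Psi>) \<longrightarrow>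
        Omega_orlicz \<phi> K / nK \<le> Hx (Omega_orlicz \<psi> K / nK) \<and>
        G_orlicz \<phi> K / nK \<le> Hx (G_orlicz \<psi> K / nK))
   \<and> ((convex_on D H \<and> antimono_on D H \<and>
       (\<phi> \<in> \<Phi> \<and> \<psi> \<in> \<Psi> \<or> \<phi> \<in> \<Psi> \<and> \<psi> \<in> \<Phi>)) \<or>
      (convex_on D H \<and> mono_on D H \<and>
       (\<phi> \<in> \<Phi> \<and> \<psi> \<in> \<Phi> \<or> \<phi> \<in> \<Psi> \<and> \<psi> \<in> \<Psi>)) \<longrightarrow>
        Omega_orlicz \<phi> K / nK \<ge> Hx (Omega_orlicz \<psi> K / nK) \<and>
        G_orlicz \<phi> K / nK \<ge> Hx (G_orlicz \<psi> K / nK))"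
proof -
  note K' = star_neighbourhood_star_body[OF K]
  have ne: "(S_tilde :: (real ^ 'n) set set) \<noteq> {}" "(K_tilde :: (real ^ 'n) set set) \<noteq> {}"
    using unit_ball_S_tilde unit_ball_K_tilde by blast+
  note Omega = orlicz_extremum_inequalities[OF K' star_neighbourhood_S_tilde ne(1) \<phi> \<psi> inverse D H,
      folded Omega_orlicz_def Hx nK \<Phi> \<Psi>]
  note G = orlicz_extremum_inequalities[OF K' star_neighbourhood_K_tilde ne(2) \<phi> \<psi> inverse D H,
      folded G_orlicz_def Hx nK \<Phi> \<Psi>]
  show ?thesis
    by (intro conjI impI) (rule Omega G; assumption)+
qed

end
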